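(* Assume that $\{\omega_x\}_{x\in\mathbb{Z}}$ are i.i.d. under $P$ with $P(\omega_0\in[c,1-c])=1$ for some $c>0$, that $E_P[\rho_0]<1$, where $\rho_x=\frac{1-\omega_x}{\omega_x}$, and that $E_P[\rho_0^s]=1$ for some $s>1$. Let $\mathrm{v}_P=\frac{1-E_P[\rho_0]}{1+E_P[\rho_0]}$. Then for any real $A<B$, any $v\in(0,\mathrm{v}_P)$, any $\delta>0$ and any $\gamma<\infty$, $$\limsup_{n\to\infty}\frac{1}{n^{1-1/s-\delta}}\log P_\omega\left(\exists\, y\in(An,Bn],\ i\le n^\gamma:\ X^{y,i}_n-y\le nv\right)=-\infty,\qquad P\text{-a.s.}$$
   Context: An environment is an element $\omega=\{\omega_x\}_{x\in\mathbb{Z}}$ of $\Omega=[0,1]^{\mathbb{Z}}$. Given $\omega$, under the quenched law $P_\omega$, $\{X^{x,i}_\cdot\}_{x\in\mathbb{Z},\,i\ge 1}$ is an independent collection of nearest-neighbor Markov chains on $\mathbb{Z}$ with $P_\omega(X^{x,i}_0=x)=1$, and from a site $y$ each chain steps to $y+1$ with probability $\omega_y$ and to $y-1$ with probability $1-\omega_y$. $P$ is a probability measure on $\Omega$ with expectation $E_P$. Here $y$ ranges over integers, $i$ over positive integers, and $\log 0=-\infty$. *)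

theory Defs
  imports "HOL-Probability.Probability"
begin

section \<open>Environments\<close>

definition env_space :: "(int \<Rightarrow> real) measure" where
  "env_space = (\<Pi>\<^sub>M x\<in>UNIV. restrict_space borel {0..1})"

lemma space_env_space: "space env_space = {\<omega>. \<forall>x. \<omega> x \<in> {0..1}}"
  by (auto simp: env_space_def space_PiM space_restrict_space)

definition iid_environment :: "(int \<Rightarrow> real) measure \<Rightarrow> bool" where
  "iid_environment P \<longleftrightarrow>
     prob_space P \<and> sets P = sets env_space \<and>
     prob_space.indep_vars P (\<lambda>_. borel) (\<lambda>x \<omega>. \<omega> x) UNIV \<and>
     (\<forall>x. distr P borel (\<lambda>\<omega>. \<omega> x) = distr P borel (\<lambda>\<omega>. \<omega> 0))"

text \<open>The convention \<open>a / 0 = 0\<close> makes \<open>rho \<omega> x = 0\<close> when \<open>\<omega> x = 0\<close>; under uniform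
  ellipticity this concerns a null event only.\<close>

definition rho :: "(int \<Rightarrow> real) \<Rightarrow> int \<Rightarrow> real" where
  "rho \<omega> x = (1 - \<omega> x) / \<omega> x"

definition speed :: "(int \<Rightarrow> real) measure \<Rightarrow> real" where
  "speed P = (1 - (\<integral>\<omega>. rho \<omega> 0 \<partial>P)) / (1 + (\<integral>\<omega>. rho \<omega> 0 \<partial>P))"


section \<open>Quenched walks\<close>

definition step_prob :: "(int \<Rightarrow> real) \<Rightarrow> int \<Rightarrow> int \<Rightarrow> real" where
  "step_prob \<omega> y z = (if z = y + 1 then \<omega> y else if z = y - 1 then 1 - \<omega> y else 0)"

definition quenched_chain ::
    "(int \<Rightarrow> real) \<Rightarrow> 'w measure \<Rightarrow> int \<Rightarrow> (nat \<Rightarrow> 'w \<Rightarrow> int) \<Rightarrow> bool" where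
  "quenched_chain \<omega> M x Y \<longleftrightarrow>
     (\<forall>n. Y n \<in> measurable M (count_space UNIV)) \<and>
     \<P>(w in M. Y 0 w = x) = 1 \<and>
     (\<forall>n p z. \<P>(w in M. \<forall>k\<le>n. Y k w = p k) \<noteq> 0 \<longrightarrow>
        \<P>(w in M. Y (Suc n) w = z \<bar> \<forall>k\<le>n. Y k w = p k) = step_prob \<omega> (p n) z)"

text \<open>\<open>X x i n\<close> is the position at time \<open>n\<close> of the \<open>i\<close>-th walk started at \<open>x\<close>.  Only indices
  \<open>i \<ge> 1\<close> are constrained, and independence is between whole trajectories.\<close>

definition quenched_walks ::
    "(int \<Rightarrow> real) \<Rightarrow> 'w measure \<Rightarrow> (int \<Rightarrow> nat \<Rightarrow> nat \<Rightarrow> 'w \<Rightarrow> int) \<Rightarrow> bool" where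
  "quenched_walks \<omega> M X \<longleftrightarrow>
     prob_space M \<and>
     prob_space.indep_vars M (\<lambda>_. \<Pi>\<^sub>M n\<in>UNIV. count_space UNIV)
       (\<lambda>(x, i) w n. X x i n w) (UNIV \<times> {1..}) \<and>
     (\<forall>x. \<forall>i\<ge>1. quenched_chain \<omega> M x (X x i))"


section \<open>Extended logarithm\<close>

definition elog :: "real \<Rightarrow> ereal" where
  "elog p = (if p \<le> 0 then -\<infinity> else ereal (ln p))"


section \<open>Existence of the quenched walks\<close>

text \<open>The coordinate process on the space of families of trajectories realises
  \<open>quenched_walks \<omega>\<close> simultaneously for all environments \<open>\<omega>\<close>.\<close>

primrec driven_walk :: "(int \<Rightarrow> real) \<Rightarrow> int \<Rightarrow> (nat \<Rightarrow> real) \<Rightarrow> nat \<Rightarrow> int" where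
  "driven_walk \<omega> x u 0 = x"
| "driven_walk \<omega> x u (Suc n) =
     driven_walk \<omega> x u n + (if u n < \<omega> (driven_walk \<omega> x u n) then 1 else -1)"

abbreviation unif :: "real measure" where
  "unif \<equiv> uniform_measure lborel {0..1}"

abbreviation noise :: "(nat \<Rightarrow> real) measure" where
  "noise \<equiv> \<Pi>\<^sub>M n\<in>UNIV. unif"

abbreviation paths :: "(nat \<Rightarrow> int) measure" where
  "paths \<equiv> \<Pi>\<^sub>M n\<in>UNIV. count_space UNIV"

definition walk_law :: "(int \<Rightarrow> real) \<Rightarrow> int \<Rightarrow> (nat \<Rightarrow> int) measure" where
  "walk_law \<omega> x = distr noise paths (driven_walk \<omega> x)"

definition canonical_law :: "(int \<Rightarrow> real) \<Rightarrow> (int \<times> nat \<Rightarrow> nat \<Rightarrow> int) measure" where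
  "canonical_law \<omega> = (\<Pi>\<^sub>M (x, i)\<in>UNIV. walk_law \<omega> x)"

lemma prob_space_unif: "prob_space unif"
  by (rule prob_space_uniform_measure) auto

lemma measure_unif_lessThan:
  assumes "0 \<le> a" "a \<le> 1"
  shows "measure unif {..<a} = a"
proof -
  have "{0..1} \<inter> {..<a} = {0..<a}"
    using assms by auto
  then show ?thesis
    using assms by (subst measure_uniform_measure) (auto simp: measure_def)
qed

lemma measurable_driven_walk_coord [measurable]:
  "(\<lambda>u. driven_walk \<omega> x u n) \<in> measurable noise (count_space UNIV)"
proof (induction n)
  case (Suc n)
  note [measurable] = Suc
  have [measurable]: "(\<lambda>u. u n) \<in> borel_measurable noise"
    using measurable_component_singleton[of n UNIV "\<lambda>_. unif"] by simp
  have "(\<lambda>u. \<omega> (driven_walk \<omega> x u n)) \<in> borel_measurable noise"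
    by (rule measurable_compose[OF Suc]) simp
  then show ?case
    by simp
qed simp

lemma measurable_driven_walk [measurable]:
  "driven_walk \<omega> x \<in> measurable noise paths"
  using measurable_PiM_single'[of UNIV "\<lambda>n u. driven_walk \<omega> x u n" noise "\<lambda>_. count_space UNIV"]
  by (simp add: space_PiM)

lemma prob_space_noise: "prob_space noise"
  by (rule prob_space_PiM) (rule prob_space_unif)

lemma prob_space_walk_law: "prob_space (walk_law \<omega> x)"
  unfolding walk_law_def by (rule prob_space.prob_space_distr[OF prob_space_noise]) simp

definition step_set :: "(int \<Rightarrow> real) \<Rightarrow> int \<Rightarrow> int \<Rightarrow> real set" where
  "step_set \<omega> y z = {r. z = y + (if r < \<omega> y then 1 else -1)}"

lemma step_set_alt:
  "step_set \<omega> y z = (if z = y + 1 then {..<\<omega> y} else if z = y - 1 then {\<omega> y..} else {})"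
  by (auto simp: step_set_def split: if_splits)

lemma step_set_measurable [measurable]: "step_set \<omega> y z \<in> sets borel"
  by (auto simp: step_set_alt)

lemma measure_step_set:
  assumes "\<omega> y \<in> {0..1}"
  shows "measure unif (step_set \<omega> y z) = step_prob \<omega> y z"
proof -
  interpret prob_space unif by (rule prob_space_unif)
  have "measure unif {\<omega> y..} = 1 - measure unif {..<\<omega> y}"
    using prob_compl[of "{..<\<omega> y}"] by (simp add: Compl_eq_Diff_UNIV[symmetric])
  then show ?thesis
    using assms by (auto simp: step_set_alt step_prob_def measure_unif_lessThan)
qed

lemma driven_walk_history:
  "(\<forall>k\<le>n. driven_walk \<omega> x u k = p k) \<longleftrightarrow>
     p 0 = x \<and> (\<forall>k<n. u k \<in> step_set \<omega> (p k) (p (Suc k)))"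
proof (induction n)
  case (Suc n)
  have "(\<forall>k\<le>Suc n. driven_walk \<omega> x u k = p k) \<longleftrightarrow>
      (\<forall>k\<le>n. driven_walk \<omega> x u k = p k) \<and> driven_walk \<omega> x u (Suc n) = p (Suc n)"
    by (auto simp: le_Suc_eq)
  also have "\<dots> \<longleftrightarrow>
      (\<forall>k\<le>n. driven_walk \<omega> x u k = p k) \<and> u n \<in> step_set \<omega> (p n) (p (Suc n))"
    by (auto simp: step_set_def)
  finally show ?case
    using Suc by (auto simp: less_Suc_eq)
qed auto

lemma sets_history: "{w \<in> space paths. \<forall>k\<le>n. w k = p k} \<in> sets paths"
proof -
  have "Measurable.pred paths (\<lambda>w. w k = p k)" for k
    by (rule measurable_compose[OF measurable_component_singleton]) simp_all
  then show ?thesis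
    by measurable
qed

lemma walk_law_history:
  assumes "\<omega> \<in> space env_space"
  shows "\<P>(w in walk_law \<omega> x. \<forall>k\<le>n. w k = p k) =
    (if p 0 = x then \<Prod>k<n. step_prob \<omega> (p k) (p (Suc k)) else 0)"
proof -
  interpret N: product_prob_space "\<lambda>_::nat. unif" UNIV
    by (rule product_prob_spaceI) (rule prob_space_unif)
  have step_sets: "step_set \<omega> y z \<in> sets unif" for y z
    by simp
  have "\<P>(w in walk_law \<omega> x. \<forall>k\<le>n. w k = p k) =
      \<P>(u in noise. \<forall>k\<le>n. driven_walk \<omega> x u k = p k)"
    using sets_history[of n p] unfolding walk_law_def
    by (subst measure_distr) (auto simp: space_PiM intro!: arg_cong2[where f=measure])
  also have "\<dots> = \<P>(u in noise. p 0 = x \<and> (\<forall>k<n. u k \<in> step_set \<omega> (p k) (p (Suc k))))"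
    by (simp only: driven_walk_history)
  also have "\<dots> = (if p 0 = x then \<Prod>k<n. step_prob \<omega> (p k) (p (Suc k)) else 0)"
  proof (cases "p 0 = x")
    case True
    have "\<P>(u in noise. \<forall>k<n. u k \<in> step_set \<omega> (p k) (p (Suc k))) =
        measure noise {u \<in> space noise. \<forall>k\<in>{..<n}. u k \<in> step_set \<omega> (p k) (p (Suc k))}"
      by (simp add: Ball_def)
    also have "\<dots> = (\<Prod>k<n. measure unif (step_set \<omega> (p k) (p (Suc k))))"
      using N.emeasure_PiM_Collect[of "{..<n}" "\<lambda>k. step_set \<omega> (p k) (p (Suc k))"] step_sets
      by (simp add: N.M.emeasure_eq_measure N.emeasure_eq_measure prod_ennreal prod_nonneg)
    also have "\<dots> = (\<Prod>k<n. step_prob \<omega> (p k) (p (Suc k)))"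
      using assms by (intro prod.cong refl measure_step_set) (auto simp: space_env_space)
    finally show ?thesis
      using True by simp
  qed simp
  finally show ?thesis .
qed

lemma quenched_walks_canonical_law:
  assumes "\<omega> \<in> space env_space"
  shows "quenched_walks \<omega> (canonical_law \<omega>) (\<lambda>x i n w. w (x, i) n)"
proof -
  let ?C = "canonical_law \<omega>"
  let ?L = "\<lambda>(x, i::nat). walk_law \<omega> x"
  have pL: "prob_space (?L j)" for j
    by (cases j) (simp add: prob_space_walk_law)
  have C: "?C = PiM UNIV ?L"
    by (simp add: canonical_law_def)
  interpret prob_space ?C
    unfolding C by (rule prob_space_PiM) (rule pL)
  have sL: "sets (?L j) = sets paths" for j
    by (cases j) (simp add: walk_law_def)
  have coord: "(\<lambda>w. w j) \<in> measurable ?C paths" for j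
    using measurable_component_singleton[of j UNIV ?L] sL[of j]
    by (simp add: C cong: measurable_cong_sets)
  have law: "distr ?C paths (\<lambda>w. w j) = ?L j" for j
  proof -
    have "distr ?C paths (\<lambda>w. w j) = distr (PiM UNIV ?L) (?L j) (\<lambda>w. w j)"
      by (rule distr_cong) (simp_all add: C sL)
    also have "\<dots> = ?L j"
      by (rule distr_PiM_component[OF pL]) simp
    finally show ?thesis .
  qed
  have "indep_vars (\<lambda>_. paths) (\<lambda>j w. w j) (UNIV :: (int \<times> nat) set)"
  proof (subst indep_vars_iff_distr_eq_PiM')
    have "distr ?C (\<Pi>\<^sub>M i\<in>UNIV. paths) (\<lambda>x. \<lambda>i\<in>UNIV. x i) = distr ?C ?C (\<lambda>x. x)"
      unfolding C using sL by (intro distr_cong sets_PiM_cong) auto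
    also have "\<dots> = PiM UNIV ?L"
      by (simp add: C)
    also have "\<dots> = (\<Pi>\<^sub>M i\<in>UNIV. distr ?C paths (\<lambda>w. w i))"
      by (simp add: law)
    finally show "distr ?C (\<Pi>\<^sub>M i\<in>UNIV. paths) (\<lambda>x. \<lambda>i\<in>UNIV. x i) =
        (\<Pi>\<^sub>M i\<in>UNIV. distr ?C paths (\<lambda>w. w i))" .
  qed (auto intro: coord)
  then have "indep_vars (\<lambda>_. paths) (\<lambda>j w. w j) (UNIV \<times> {1..})"
    by (rule indep_vars_subset) simp
  then have indep: "indep_vars (\<lambda>_. paths) (\<lambda>(x, i) w n. w (x, i) n) (UNIV \<times> {1..})"
    by (simp add: case_prod_unfold)
  have "quenched_chain \<omega> ?C x (\<lambda>n w. w (x, i) n)" for x i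
  proof -
    have meas [measurable]: "(\<lambda>w. w (x, i) n) \<in> measurable ?C (count_space UNIV)" for n
      by (rule measurable_compose[OF coord]) simp
    have hist: "\<P>(w in ?C. \<forall>k\<le>n. w (x, i) k = p k) =
        (if p 0 = x then \<Prod>k<n. step_prob \<omega> (p k) (p (Suc k)) else 0)" for n p
    proof -
      have "\<P>(w in ?C. \<forall>k\<le>n. w (x, i) k = p k) =
          \<P>(w in distr ?C paths (\<lambda>w. w (x, i)). \<forall>k\<le>n. w k = p k)"
        using coord[of "(x, i)"] sets_history[of n p]
        by (subst measure_distr) (auto simp: space_PiM intro!: arg_cong2[where f=measure])
      also have "\<dots> = \<P>(w in walk_law \<omega> x. \<forall>k\<le>n. w k = p k)"
        by (simp add: law)
      finally show ?thesis
        using walk_law_history[OF assms] by simp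
    qed
    have "\<P>(w in ?C. w (x, i) (Suc n) = z \<bar> \<forall>k\<le>n. w (x, i) k = p k) = step_prob \<omega> (p n) z"
      if nz: "\<P>(w in ?C. \<forall>k\<le>n. w (x, i) k = p k) \<noteq> 0" for n p z
    proof -
      define q where "q = p(Suc n := z)"
      have "(w (x, i) (Suc n) = z \<and> (\<forall>k\<le>n. w (x, i) k = p k)) \<longleftrightarrow>
          (\<forall>k\<le>Suc n. w (x, i) k = q k)" for w :: "int \<times> nat \<Rightarrow> nat \<Rightarrow> int"
        by (auto simp: q_def le_Suc_eq)
      then have "\<P>(w in ?C. w (x, i) (Suc n) = z \<and> (\<forall>k\<le>n. w (x, i) k = p k)) =
          (if q 0 = x then \<Prod>k<Suc n. step_prob \<omega> (q k) (q (Suc k)) else 0)"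
        by (simp only: hist)
      also have "\<dots> = \<P>(w in ?C. \<forall>k\<le>n. w (x, i) k = p k) * step_prob \<omega> (p n) z"
        by (simp add: hist q_def)
      finally show ?thesis
        using nz by (simp add: cond_prob_def)
    qed
    moreover have "\<P>(w in ?C. w (x, i) 0 = x) = 1"
      using hist[of 0 "\<lambda>_. x"] by simp
    ultimately show ?thesis
      unfolding quenched_chain_def using meas by blast
  qed
  then show ?thesis
    unfolding quenched_walks_def using indep prob_space_axioms by blast
qed

end

theory Submission
  imports Defs "HOL-Real_Asymp.Real_Asymp"
begin

text \<open>
  Suppose that \<open>g \<ge> 0\<close> satisfies \<open>g j \<ge> (g j)\<^sup>2 + rho j * g (j - 1) + l * (1 + rho j)\<close> on the
  sites that a walk from \<open>y\<close> can reach in \<open>n\<close> steps.  Then a function \<open>G\<close> with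
  \<open>G j = (1 + g j) * G (j + 1)\<close> decreases by a factor \<open>exp (- l)\<close> in expectation at each
  step of the walk, and since \<open>G\<close> is decreasing in \<open>j\<close>, the walk is at or below \<open>y + m\<close> at time
  \<open>n\<close> with probability at most \<open>exp (- l * n + (\<Sum>i<m. g (y + i)))\<close>.  No hitting times and no
  control of backtracking are required.

  Such a \<open>g\<close> is \<open>(1 + \<kappa>) * l\<close> times the quenched expected crossing time \<open>h j\<close> from \<open>j\<close> to
  \<open>j + 1\<close>, computed with \<open>rho\<close> slightly inflated: \<open>h j = 1 + rho j + (1 + \<kappa>) * rho j * h (j - 1)\<close>.
  The inflation absorbs the quadratic term as long as \<open>l * h\<close> is small.  Since
  \<open>E (rho powr p) < 1\<close> for \<open>1 < p < s\<close>, almost surely \<open>h j\<close> is of order at most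
  \<open>\<bar>j\<bar> powr (1 / s + \<tau>)\<close>, so \<open>l = n powr (- 1 / s - 4 * \<tau>)\<close> is admissible.  An exponential
  moment bound for \<open>h\<close> truncated to finite depth, which has a finite range of dependence, shows
  that \<open>h\<close> averages to nearly \<open>1 / speed\<close> on all the intervals in question, and then
  the exponent is at most a negative multiple of \<open>l * n\<close>.
\<close>

section \<open>Supersolutions for the quenched walk\<close>

text \<open>The backward equation for the probability that a walk from \<open>j\<close> is in
  \<open>S\<close> after \<open>m\<close> steps. It involves only \<open>\<omega>\<close>, so the
  estimates below need no probability space for the walks.\<close>

primrec iter_step :: "(int \<Rightarrow> real) \<Rightarrow> int set \<Rightarrow> nat \<Rightarrow> int \<Rightarrow> real" where
  "iter_step \<omega> S 0 j = indicator S j"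
| "iter_step \<omega> S (Suc m) j =
     \<omega> j * iter_step \<omega> S m (j + 1) + (1 - \<omega> j) * iter_step \<omega> S m (j - 1)"

text \<open>Induction on the remaining time \<open>m\<close> with an arbitrary history: the
  induction hypothesis is applied to the history lengthened by one site, and the possible next sites
  are summed.\<close>

lemma quenched_chain_history:
  assumes M: "prob_space M" and chain: "quenched_chain \<omega> M x Y"
  shows "\<P>(w in M. Y (k + m) w \<in> S \<and> (\<forall>i\<le>k. Y i w = p i)) =
    \<P>(w in M. \<forall>i\<le>k. Y i w = p i) * iter_step \<omega> S m (p k)"
proof (induction m arbitrary: k p)
  case 0
  show ?case
  proof (cases "p k \<in> S")
    case True
    then have "(Y (k + 0) w \<in> S \<and> (\<forall>i\<le>k. Y i w = p i)) \<longleftrightarrow> (\<forall>i\<le>k. Y i w = p i)" for w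
      by auto
    with True show ?thesis by simp
  next
    case False
    then have "\<not> (Y (k + 0) w \<in> S \<and> (\<forall>i\<le>k. Y i w = p i))" for w
      by auto
    with False show ?thesis by (simp only: Collect_empty_eq simp_thms) simp
  qed
next
  case (Suc m)
  interpret prob_space M by fact
  have [measurable]: "Y n \<in> measurable M (count_space UNIV)" for n
    using chain by (simp add: quenched_chain_def)
  let ?h = "\<lambda>w. \<forall>i\<le>k. Y i w = p i"
  let ?q = "\<lambda>z. p(Suc k := z)"
  have hq: "(\<forall>i\<le>Suc k. Y i w = ?q z i) \<longleftrightarrow> Y (Suc k) w = z \<and> ?h w" for w z
    by (auto simp: le_Suc_eq)
  \<comment> \<open>The chain prescribes conditional probabilities only given histories of positive
    probability. In this product form null histories are covered as well.\<close>
  have step: "\<P>(w in M. Y (Suc k) w = z \<and> ?h w) = \<P>(w in M. ?h w) * step_prob \<omega> (p k) z" for z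
  proof (cases "\<P>(w in M. ?h w) = 0")
    case True
    have "\<P>(w in M. Y (Suc k) w = z \<and> ?h w) \<le> \<P>(w in M. ?h w)"
      by (intro finite_measure_mono) auto
    with True show ?thesis by (simp add: measure_le_0_iff)
  next
    case False
    then have "\<P>(w in M. Y (Suc k) w = z \<bar> ?h w) = step_prob \<omega> (p k) z"
      using chain by (auto simp: quenched_chain_def)
    with False show ?thesis by (simp add: cond_prob_def field_simps)
  qed
  let ?E = "\<lambda>z. {w \<in> space M. Y (k + Suc m) w \<in> S \<and> Y (Suc k) w = z \<and> ?h w}"
  let ?H = "\<lambda>z. {w \<in> space M. Y (Suc k) w = z \<and> ?h w}"
  let ?u = "p k + 1" and ?d = "p k - 1"
  have E: "prob (?E z) = \<P>(w in M. ?h w) * step_prob \<omega> (p k) z * iter_step \<omega> S m z" for z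
    using Suc.IH[of "Suc k" "?q z"] unfolding hq step by simp
  \<comment> \<open>That the next site is a neighbour of \<open>p k\<close> is not given pathwise,
    so a remainder term is kept.\<close>
  have split: "prob A = prob (A \<inter> ?H ?u) + prob (A \<inter> ?H ?d) + prob (A - (?H ?u \<union> ?H ?d))"
    if [measurable]: "A \<in> sets M" for A
  proof -
    have "prob A = prob (A \<inter> ?H ?u \<union> A \<inter> ?H ?d \<union> (A - (?H ?u \<union> ?H ?d)))"
      by (rule arg_cong[where f = prob]) auto
    also have "\<dots> = prob (A \<inter> ?H ?u \<union> A \<inter> ?H ?d) + prob (A - (?H ?u \<union> ?H ?d))"
      by (rule finite_measure_Union) auto
    also have "prob (A \<inter> ?H ?u \<union> A \<inter> ?H ?d) = prob (A \<inter> ?H ?u) + prob (A \<inter> ?H ?d)"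
      by (rule finite_measure_Union) auto
    finally show ?thesis .
  qed
  let ?B = "{w \<in> space M. ?h w}"
  have "?B \<inter> ?H z = ?H z" for z by auto
  \<comment> \<open>The two step probabilities add up to 1, which forces the remainder to be
    null.\<close>
  then have "prob (?B - (?H ?u \<union> ?H ?d)) = 0"
    using split[of ?B] unfolding \<open>\<And>z. ?B \<inter> ?H z = ?H z\<close> step
    by (simp add: step_prob_def algebra_simps)
  moreover let ?A = "{w \<in> space M. Y (k + Suc m) w \<in> S \<and> ?h w}"
  have "prob (?A - (?H ?u \<union> ?H ?d)) \<le> prob (?B - (?H ?u \<union> ?H ?d))"
    by (intro finite_measure_mono) auto
  ultimately have "prob (?A - (?H ?u \<union> ?H ?d)) = 0"
    by (simp add: measure_le_0_iff)
  moreover have "?A \<inter> ?H z = ?E z" for z by auto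
  ultimately have "prob ?A = prob (?E ?u) + prob (?E ?d)"
    using split[of ?A] by simp
  then show ?case
    unfolding E by (simp add: step_prob_def algebra_simps)
qed

lemma quenched_chain_law:
  assumes M: "prob_space M" and chain: "quenched_chain \<omega> M x Y"
  shows "\<P>(w in M. Y n w \<in> S) = iter_step \<omega> S n x"
proof -
  interpret prob_space M by fact
  have [measurable]: "Y n \<in> measurable M (count_space UNIV)" for n
    using chain by (simp add: quenched_chain_def)
  have "\<P>(w in M. Y 0 w = x) = 1"
    using chain by (simp add: quenched_chain_def)
  then have "AE w in M. Y 0 w = x"
    by (subst (asm) prob_Collect_eq_1) auto
  then have "\<P>(w in M. Y n w \<in> S) = \<P>(w in M. Y (0 + n) w \<in> S \<and> (\<forall>i\<le>0. Y i w = x))"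
    by (intro finite_measure_eq_AE) auto
  also have "\<dots> = iter_step \<omega> S n x"
    using quenched_chain_history[OF assms, where k = 0 and m = n and S = S and p = "\<lambda>_. x"]
      \<open>\<P>(w in M. Y 0 w = x) = 1\<close> by simp
  finally show ?thesis .
qed

text \<open>A supermartingale argument phrased through \<open>iter_step\<close>: one step averages
  \<open>G\<close> to at most \<open>exp (- l) * G\<close>, and \<open>G j / G z\<close> dominates
  the indicator of being at or below \<open>z\<close>. The ratio \<open>G y / G z\<close> is a
  product over the \<open>m\<close> sites from \<open>y\<close> up to \<open>z\<close>, and
  \<open>1 + x \<le> exp x\<close> turns it into the exponential of a sum.\<close>

lemma iter_step_le:
  fixes g :: "int \<Rightarrow> real"
  assumes \<omega>: "\<And>j. 0 < \<omega> j" "\<And>j. \<omega> j \<le> 1" and g: "\<And>j. 0 \<le> g j"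
    and sup: "\<And>j. \<bar>j - y\<bar> \<le> int n \<Longrightarrow> g j \<ge> g j ^ 2 + rho \<omega> j * g (j - 1) + l * (1 + rho \<omega> j)"
  shows "iter_step \<omega> {..y + int m} n y \<le> exp (- l * real n + (\<Sum>i<m. g (y + int i)))"
proof -
  define z where "z = y + int m"
  \<comment> \<open>Chosen to the right of \<open>z\<close> and of every site within distance
    \<open>n\<close> of \<open>y\<close>, so that the finite product \<open>G\<close> satisfies its
    recursion wherever it is needed.\<close>
  define r where "r = y + int n + int m + 1"
  define G where "G j = (\<Prod>i\<in>{j..<r}. 1 + g i)" for j
  have Gpos: "G j > 0" for j
    unfolding G_def using g by (intro prod_pos) (auto simp: add_pos_nonneg)
  have G_rec: "G j = (1 + g j) * G (j + 1)" if "j < r" for j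
  proof -
    have "{j..<r} = insert j {j+1..<r}" using that by auto
    then show ?thesis unfolding G_def by simp
  qed
  have local: "\<omega> j * G (j + 1) + (1 - \<omega> j) * G (j - 1) \<le> exp (-l) * G j"
    if j: "\<bar>j - y\<bar> \<le> int n" for j
  proof -
    have "j < r" using j by (auto simp: r_def)
    have rho: "\<omega> j * rho \<omega> j = 1 - \<omega> j" "\<omega> j * (1 + rho \<omega> j) = 1"
      using \<omega>(1)[of j] by (auto simp: rho_def field_simps)
    \<comment> \<open>After division by \<open>\<omega> j * G j\<close> the left side of the claim
      is \<open>1 / (1 + g j) + rho \<omega> j * (1 + g (j - 1))\<close>. This bound on its first
      term is the source of the quadratic term in \<open>sup\<close>.\<close>
    have "1 / (1 + g j) \<le> 1 - g j + (g j)\<^sup>2"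
      using g[of j] by (simp add: field_simps power2_eq_square) 
    moreover have "1 + -l \<le> exp (-l)" by (rule exp_ge_add_one_self)
    ultimately have "1 / (1 + g j) + rho \<omega> j * (1 + g (j - 1)) \<le> (1 + rho \<omega> j) * (1 - l)"
      using sup[OF j] by (simp add: algebra_simps)
    then have "\<omega> j * (1 / (1 + g j) + rho \<omega> j * (1 + g (j - 1))) \<le> \<omega> j * ((1 + rho \<omega> j) * (1 - l))"
      using \<omega>(1)[of j] by (intro mult_left_mono) auto
    also have "\<omega> j * ((1 + rho \<omega> j) * (1 - l)) = 1 - l"
      using rho by (simp flip: mult.assoc)
    also have "\<dots> \<le> exp (-l)" using exp_ge_add_one_self[of "-l"] by simp
    also have "\<omega> j * (1 / (1 + g j) + rho \<omega> j * (1 + g (j - 1)))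
        = \<omega> j / (1 + g j) + (1 - \<omega> j) * (1 + g (j - 1))"
      using rho by (simp add: ring_distribs flip: mult.assoc)
    finally have "(\<omega> j / (1 + g j) + (1 - \<omega> j) * (1 + g (j - 1))) * G j \<le> exp (-l) * G j"
      using Gpos[of j] by (intro mult_right_mono) auto
    moreover have "G j / (1 + g j) = G (j + 1)"
      using G_rec[OF \<open>j < r\<close>] g[of j] by (simp add: field_simps)
    moreover have "G (j - 1) = (1 + g (j - 1)) * G j"
      using G_rec[of "j - 1"] \<open>j < r\<close> by simp
    moreover have "\<omega> j / (1 + g j) * G j = \<omega> j * (G j / (1 + g j))" by simp
    ultimately show ?thesis
      by (simp only: distrib_right mult.assoc)
  qed
  \<comment> \<open>The side condition keeps the walk from \<open>j\<close> within distance
    \<open>n\<close> of \<open>y\<close> for the remaining \<open>k\<close> steps, where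
    \<open>sup\<close> is available.\<close>
  have "iter_step \<omega> {..z} k j \<le> exp (- l * real k) * (G j / G z)" if "\<bar>j - y\<bar> + int k \<le> int n" for k j
    using that
  proof (induction k arbitrary: j)
    case 0
    have "G z \<le> G j" if "j \<le> z"
      unfolding G_def using that g by (intro prod_mono2) (auto simp: add_pos_nonneg)
    then show ?case
      using Gpos[of z] Gpos[of j] by (auto simp: indicator_def field_simps)
  next
    case (Suc k)
    have "iter_step \<omega> {..z} (Suc k) j \<le> \<omega> j * (exp (- l * real k) * (G (j + 1) / G z))
        + (1 - \<omega> j) * (exp (- l * real k) * (G (j - 1) / G z))"
      unfolding iter_step.simps using Suc.prems \<omega>(1)[of j] \<omega>(2)[of j]
      by (intro add_mono mult_left_mono Suc.IH) auto
    also have "\<dots> = exp (- l * real k) * (\<omega> j * G (j + 1) + (1 - \<omega> j) * G (j - 1)) / G z"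
      using Gpos[of z] by (simp add: field_simps)
    also have "\<dots> \<le> exp (- l * real k) * (exp (-l) * G j) / G z"
      using Suc.prems Gpos[of z] by (intro divide_right_mono mult_left_mono local) auto
    also have "\<dots> = exp (- l * real (Suc k)) * (G j / G z)"
      by (simp add: algebra_simps flip: exp_add)
    finally show ?case .
  qed
  then have "iter_step \<omega> {..z} n y \<le> exp (- l * real n) * (G y / G z)" by simp
  also have "G y / G z = (\<Prod>i\<in>{y..<z}. 1 + g i)"
  proof -
    have "{y..<r} = {y..<z} \<union> {z..<r}" by (auto simp: z_def r_def)
    moreover have "{y..<z} \<inter> {z..<r} = {}" by auto
    ultimately have "G y = (\<Prod>i\<in>{y..<z}. 1 + g i) * G z"
      unfolding G_def by (simp add: prod.union_disjoint)
    then show ?thesis using Gpos[of z] by simp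
  qed
  also have "\<dots> = (\<Prod>i<m. 1 + g (y + int i))"
    by (rule prod.reindex_bij_witness[of _ "\<lambda>i. y + int i" "\<lambda>j. nat (j - y)"]) (auto simp: z_def)
  also have "\<dots> \<le> (\<Prod>i<m. exp (g (y + int i)))"
    using g by (intro prod_mono) (auto simp: add_nonneg_nonneg)
  also have "\<dots> = exp (\<Sum>i<m. g (y + int i))"
    by (simp add: exp_sum)
  finally show ?thesis
    unfolding z_def exp_add by simp
qed

section \<open>Inflated crossing times\<close>

text \<open>\<open>crossing_time 0 N (rho \<omega>) j\<close> is the quenched expected time to go from \<open>j\<close> to \<open>j + 1\<close>,
  as a series over the sites to the left of \<open>j\<close> cut off after \<open>N\<close> terms.\<close>

definition crossing_time :: "real \<Rightarrow> nat \<Rightarrow> (int \<Rightarrow> real) \<Rightarrow> int \<Rightarrow> real" where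
  "crossing_time \<kappa> N r j =
     (\<Sum>k<N. (1 + \<kappa>) ^ k * ((1 + r (j - int k)) * (\<Prod>i<k. r (j - int i))))"

text \<open>The term \<open>k = 0\<close> is split off and the others are shifted by one site. The
  depth drops by one, so at a fixed depth the recursion closes only up to the last term of the
  series.\<close>

lemma crossing_time_Suc:
  "crossing_time \<kappa> (Suc N) r j = 1 + r j + (1 + \<kappa>) * r j * crossing_time \<kappa> N r (j - 1)"
proof -
  have shift: "j - int (Suc k) = j - 1 - int k" for k by simp
  show ?thesis
    unfolding crossing_time_def sum.lessThan_Suc_shift prod.lessThan_Suc_shift shift
    by (simp add: sum_distrib_left mult_ac)
qed

lemma crossing_time_nonneg:
  assumes "\<kappa> \<ge> 0" "\<And>j. r j \<ge> 0"
  shows "crossing_time \<kappa> N r j \<ge> 0"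
  unfolding crossing_time_def using assms
  by (intro sum_nonneg mult_nonneg_nonneg prod_nonneg) (auto simp: add_nonneg_nonneg)

text \<open>With \<open>A = l * (1 + r j)\<close> and \<open>B = r j * g (j - 1)\<close>, the factor
  \<open>1 + \<kappa>\<close> provides a surplus \<open>\<kappa> * A + \<kappa> * B\<close>.
  Smallness of \<open>g j\<close> bounds its square by half of this surplus, and the error from
  cutting off the series costs at most \<open>\<kappa> / 2 * A\<close>.\<close>

lemma crossing_time_supersolution:
  fixes \<kappa> l :: real and N :: nat and r :: "int \<Rightarrow> real"
  defines "g \<equiv> \<lambda>j. (1 + \<kappa>) * l * crossing_time \<kappa> (Suc N) r j"
  assumes r: "\<And>j. r j \<ge> 0" and "\<kappa> > 0" "l \<ge> 0"
    and small: "g j \<le> \<kappa> / (2 * (1 + \<kappa>))"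
    and last: "(1 + \<kappa>) ^ N * ((1 + r (j - 1 - int N)) * (\<Prod>i<N. r (j - 1 - int i)))
      \<le> \<kappa> / (2 * (1 + \<kappa>)\<^sup>2)"
  shows "g j \<ge> (g j)\<^sup>2 + r j * g (j - 1) + l * (1 + r j)"
proof -
  \<comment> \<open>The last term of the series of depth \<open>Suc N\<close> at
    \<open>j - 1\<close>, by which it exceeds the series of depth \<open>N\<close> that appears in
    the recursion.\<close>
  define a where "a = (1 + \<kappa>) ^ N * ((1 + r (j - 1 - int N)) * (\<Prod>i<N. r (j - 1 - int i)))"
  have a: "(1 + \<kappa>)\<^sup>2 * a \<le> \<kappa> / 2" "a \<ge> 0"
    using last \<open>\<kappa> > 0\<close> r unfolding a_def[symmetric]
     apply (simp add: field_simps)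
    using \<open>\<kappa> > 0\<close> r unfolding a_def
    by (intro mult_nonneg_nonneg prod_nonneg add_nonneg_nonneg zero_le_power) auto
  have g_nonneg: "g i \<ge> 0" for i
    unfolding g_def using assms by (intro mult_nonneg_nonneg crossing_time_nonneg) auto
  have "crossing_time \<kappa> (Suc N) r (j - 1) = crossing_time \<kappa> N r (j - 1) + a"
    by (simp add: crossing_time_def a_def)
  then have g: "g j = (1 + \<kappa>) * (l * (1 + r j)) + (1 + \<kappa>) * (r j * g (j - 1))
      - (1 + \<kappa>)\<^sup>2 * a * (l * r j)"
    unfolding g_def crossing_time_Suc[of \<kappa> N r j] by (simp add: algebra_simps power2_eq_square)
  have 1: "(1 + \<kappa>)\<^sup>2 * a * (l * r j) \<le> \<kappa> / 2 * (l * (1 + r j))"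
    using a(1) \<open>\<kappa> > 0\<close> \<open>l \<ge> 0\<close> r[of j] by (intro mult_mono) auto
  have "0 \<le> (1 + \<kappa>)\<^sup>2 * a * (l * r j)"
    using a(2) \<open>l \<ge> 0\<close> r[of j] by simp
  with g have "g j \<le> (1 + \<kappa>) * (l * (1 + r j) + r j * g (j - 1))"
    by (simp add: algebra_simps)
  then have "(g j)\<^sup>2 \<le> \<kappa> / (2 * (1 + \<kappa>)) * ((1 + \<kappa>) * (l * (1 + r j) + r j * g (j - 1)))"
    unfolding power2_eq_square using small g_nonneg \<open>\<kappa> > 0\<close> by (intro mult_mono) auto
  also have "\<dots> = \<kappa> / 2 * (l * (1 + r j)) + \<kappa> / 2 * (r j * g (j - 1))"
    using \<open>\<kappa> > 0\<close> by (simp add: field_simps)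
  finally have 2: "(g j)\<^sup>2 \<le> \<kappa> / 2 * (l * (1 + r j)) + \<kappa> / 2 * (r j * g (j - 1))" .
  have "0 \<le> \<kappa> / 2 * (r j * g (j - 1))"
    using \<open>\<kappa> > 0\<close> r[of j] g_nonneg by simp
  moreover define A B where "A = l * (1 + r j)" and "B = r j * g (j - 1)"
  moreover have "g j = A + \<kappa> * A + B + \<kappa> * B - (1 + \<kappa>)\<^sup>2 * a * (l * r j)"
    using g by (simp add: A_def B_def distrib_right)
  ultimately show ?thesis
    using 1 2 by simp
qed

lemma crossing_time_le:
  assumes "\<kappa> \<ge> 0" "\<And>j. 0 \<le> r j" "\<And>j. r j \<le> R" "\<beta> \<ge> 0" "(1 + \<kappa>) * \<beta> < 1"
    and C: "\<And>k. (\<Prod>i<k. r (j - int i)) \<le> C * \<beta> ^ k"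
  shows "crossing_time \<kappa> N r j \<le> (1 + R) * C / (1 - (1 + \<kappa>) * \<beta>)"
proof -
  have "C \<ge> 0" using C[of 0] by simp
  have "R \<ge> 0" using assms(2,3)[of 0] by linarith
  have "crossing_time \<kappa> N r j \<le> (\<Sum>k<N. (1 + \<kappa>) ^ k * ((1 + R) * (C * \<beta> ^ k)))"
    unfolding crossing_time_def using assms \<open>R \<ge> 0\<close>
    by (intro sum_mono mult_left_mono mult_mono prod_nonneg) auto
  also have "\<dots> = (1 + R) * C * (\<Sum>k<N. ((1 + \<kappa>) * \<beta>) ^ k)"
    by (simp add: sum_distrib_left power_mult_distrib mult_ac)
  also have "(\<Sum>k<N. ((1 + \<kappa>) * \<beta>) ^ k) \<le> (\<Sum>k. ((1 + \<kappa>) * \<beta>) ^ k)"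
    using assms by (intro sum_le_suminf summable_geometric) auto
  also have "\<dots> = 1 / (1 - (1 + \<kappa>) * \<beta>)"
    using assms by (intro suminf_geometric) auto
  finally show ?thesis
    using \<open>C \<ge> 0\<close> \<open>R \<ge> 0\<close> by (simp add: mult_left_mono)
qed

text \<open>Finite range of dependence: together with measurability in the same window of sites,
  this yields the independence of distant truncated crossing times.\<close>

lemma crossing_time_cong:
  assumes "\<And>k. k < N \<Longrightarrow> r (j - int k) = r' (j - int k)"
  shows "crossing_time \<kappa> N r j = crossing_time \<kappa> N r' j"
  unfolding crossing_time_def using assms
  by (intro sum.cong prod.cong arg_cong2[where f = "(*)"] refl) auto

lemma crossing_time_measurable:
  assumes "{j - int N<..j} \<subseteq> K"
  shows "(\<lambda>x. crossing_time \<kappa> N x j) \<in> borel_measurable (PiM K (\<lambda>_. borel))"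
proof -
  have comp: "(\<lambda>x. x (j - int k)) \<in> borel_measurable (PiM K (\<lambda>_. borel :: real measure))" if "k < N" for k
    using assms that by (intro measurable_component_singleton) auto
  show ?thesis
    unfolding crossing_time_def
    by (intro borel_measurable_sum borel_measurable_times borel_measurable_add borel_measurable_const
        borel_measurable_prod comp) auto
qed

section \<open>Almost sure bounds for bounded i.i.d. ratios\<close>

text \<open>The bounds hold at every point, not only almost surely. Elliptic environments fit in
  through a truncation of the ratios that changes them on a null event only.\<close>

locale bounded_iid = prob_space M for M :: "'a measure" +
  fixes r :: "int \<Rightarrow> 'a \<Rightarrow> real" and R :: real
  assumes indep: "indep_vars (\<lambda>_. borel) r UNIV"
    and ident: "distr M borel (r j) = distr M borel (r 0)"
    and nonneg: "0 \<le> r j w" and bounded: "r j w \<le> R"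
begin

lemma measurable_r [measurable]: "r j \<in> borel_measurable M"
  using indep by (auto simp: indep_vars_def)

lemma expectation_prod:
  assumes [measurable]: "f \<in> borel_measurable borel" and int: "integrable M (\<lambda>w. f (r 0 w))"
  shows "integrable M (\<lambda>w. \<Prod>i<k. f (r (j - int i) w))"
    and "expectation (\<lambda>w. \<Prod>i<k. f (r (j - int i) w)) = expectation (\<lambda>w. f (r 0 w) :: real) ^ k"
proof -
  have int_j: "integrable M (\<lambda>w. f (r j w))" for j
  proof -
    have "integrable (distr M borel (r 0)) f"
      using int by (subst integrable_distr_eq) auto
    then show ?thesis
      unfolding ident[of j, symmetric] by (subst (asm) integrable_distr_eq) auto
  qed
  have E_j: "expectation (\<lambda>w. f (r j w)) = expectation (\<lambda>w. f (r 0 w))" for j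
    using integral_distr[of "r j" M borel f] integral_distr[of "r 0" M borel f] ident[of j] by simp
  have ind: "indep_vars (\<lambda>_. borel) (\<lambda>i w. f (r i w)) {j - int k<..j}"
    by (rule indep_vars_subset[OF indep_vars_compose2[OF indep]]) auto
  have eq: "(\<Prod>i<k. f (r (j - int i) w)) = (\<Prod>i\<in>{j - int k<..j}. f (r i w))" for w
    by (rule prod.reindex_bij_witness[of _ "\<lambda>i. nat (j - i)" "\<lambda>i. j - int i"]) auto
  show "integrable M (\<lambda>w. \<Prod>i<k. f (r (j - int i) w))"
    unfolding eq by (rule indep_vars_integrable[OF _ ind]) (auto intro: int_j)
  show "expectation (\<lambda>w. \<Prod>i<k. f (r (j - int i) w)) = expectation (\<lambda>w. f (r 0 w)) ^ k"
  proof -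
    have "expectation (\<lambda>w. \<Prod>i\<in>{j - int k<..j}. f (r i w))
        = (\<Prod>i\<in>{j - int k<..j}. expectation (\<lambda>w. f (r i w)))"
      by (rule indep_vars_lebesgue_integral[OF _ ind]) (auto intro: int_j)
    also have "\<dots> = (\<Prod>i\<in>{j - int k<..j}. expectation (\<lambda>w. f (r 0 w)))"
      by (intro prod.cong refl E_j)
    finally show ?thesis
      unfolding eq by simp
  qed
qed

lemma integrable_r_powr: "p \<ge> 0 \<Longrightarrow> integrable M (\<lambda>w. r 0 w powr p)"
  by (rule integrable_const_bound[where B = "R powr p"]) (auto simp: nonneg bounded intro!: powr_mono2)

lemma integrable_r: "integrable M (r 0)"
  by (rule integrable_const_bound[where B = R]) (auto simp: nonneg bounded)

text \<open>The weighted \<open>p\<close>-th powers of all the products have a finite total expectation.\<close>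

lemma AE_prod_growth:
  assumes "p > 0" "\<beta> > 0" "p * a > 1" and q: "expectation (\<lambda>w. r 0 w powr p) < \<beta> powr p"
  shows "AE w in M. \<exists>C. \<forall>j k. (\<Prod>i<k. r (j - int i) w) \<le> C * \<beta> ^ k * (1 + real_of_int \<bar>j\<bar>) powr a"
proof -
  define x where "x = expectation (\<lambda>w. r 0 w powr p) / \<beta> powr p"
  have x: "0 \<le> x" "x < 1"
    using q \<open>\<beta> > 0\<close> by (auto simp: x_def field_simps intro!: divide_nonneg_nonneg integral_nonneg_AE)
  define D where "D j = (1 + real_of_int \<bar>j\<bar>) powr (p * a)" for j
  have D: "D j > 0" for j by (auto simp: D_def)
  \<comment> \<open>Division by \<open>(\<beta> powr p) ^ k\<close> makes the expectations geometric
    in \<open>k\<close>, and division by \<open>D j\<close> makes them summable over the sites,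
    because \<open>p * a > 1\<close>.\<close>
  define Y where "Y j k w = (\<Prod>i<k. r (j - int i) w powr p) / (\<beta> powr p) ^ k / D j" for j k w
  have Y_nonneg: "Y j k w \<ge> 0" for j k w
    using D[of j] by (auto simp: Y_def intro!: divide_nonneg_nonneg prod_nonneg)
  have Y_int: "integrable M (Y j k)" for j k
    using expectation_prod(1)[of "\<lambda>x. x powr p"] integrable_r_powr[of p] \<open>p > 0\<close>
    unfolding Y_def by (intro integrable_divide) auto
  have [measurable]: "Y j k \<in> borel_measurable M" for j k
    using Y_int by auto
  have EY: "expectation (Y j k) = x ^ k / D j" for j k
    using expectation_prod(2)[of "\<lambda>x. x powr p"] integrable_r_powr[of p] \<open>p > 0\<close>
    unfolding Y_def x_def by (simp add: power_divide)
  \<comment> \<open>The sites \<open>n\<close> and \<open>- n\<close> are paired to obtain a series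
    over the naturals; site 0 is counted twice, which does no harm.\<close>
  define Z where "Z n k w = Y (int n) k w + Y (- int n) k w" for n k w
  have Z: "Z n k w \<ge> 0" for n k w using Y_nonneg by (simp add: Z_def)
  have Z_int: "integrable M (Z n k)" for n k
    unfolding Z_def[abs_def] using Y_int by auto
  have [measurable]: "Z n k \<in> borel_measurable M" for n k
    using Z_int by auto
  have EZ: "(\<integral>\<^sup>+w. ennreal (Z n k w) \<partial>M) = ennreal (2 * x ^ k / D (int n))" for n k
  proof -
    have "(\<integral>\<^sup>+w. ennreal (Z n k w) \<partial>M) = ennreal (expectation (Z n k))"
      using Z Z_int by (intro nn_integral_eq_integral) auto
    also have "expectation (Z n k) = 2 * x ^ k / D (int n)"
      unfolding Z_def[abs_def] using Y_int EY by (simp add: D_def)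
    finally show ?thesis .
  qed
  have "(\<integral>\<^sup>+w. (\<Sum>n. \<Sum>k. ennreal (Z n k w)) \<partial>M) = (\<Sum>n. \<Sum>k. ennreal (2 * x ^ k / D (int n)))"
    by (simp add: nn_integral_suminf EZ)
  also have "\<dots> = (\<Sum>n. ennreal (2 / (1 - x) / D (int n)))"
  proof (intro suminf_cong)
    fix n
    have "(\<lambda>k. 2 / D (int n) * x ^ k) sums (2 / D (int n) * (1 / (1 - x)))"
      using x by (intro sums_mult geometric_sums) auto
    then show "(\<Sum>k. ennreal (2 * x ^ k / D (int n))) = ennreal (2 / (1 - x) / D (int n))"
      using x D[of "int n"] by (intro suminf_ennreal_eq) (auto simp: field_simps)
  qed
  also have "\<dots> = ennreal (\<Sum>n. 2 / (1 - x) / D (int n))"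
  proof (rule suminf_ennreal2)
    have "summable (\<lambda>n. real (Suc n) powr (- (p * a)))"
      using \<open>p * a > 1\<close> by (subst summable_Suc_iff) (simp add: summable_real_powr_iff)
    then have "summable (\<lambda>n. 2 / (1 - x) * real (Suc n) powr (- (p * a)))"
      by (rule summable_mult)
    then show "summable (\<lambda>n. 2 / (1 - x) / D (int n))"
      by (simp add: D_def powr_minus_divide field_simps)
  qed (use x D in \<open>auto intro!: divide_nonneg_nonneg less_imp_le\<close>)
  finally have "(\<integral>\<^sup>+w. (\<Sum>n. \<Sum>k. ennreal (Z n k w)) \<partial>M) \<noteq> \<infinity>" by simp
  then have "AE w in M. (\<Sum>n. \<Sum>k. ennreal (Z n k w)) \<noteq> \<infinity>"
    by (intro nn_integral_PInf_AE) auto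
  then show ?thesis
  proof eventually_elim
    case (elim w)
    then obtain T where T: "T \<ge> 0" "(\<Sum>n. \<Sum>k. ennreal (Z n k w)) = ennreal T"
      by (cases "\<Sum>n. \<Sum>k. ennreal (Z n k w)") auto
    have Z_le: "Z n k w \<le> T" for n k
    proof -
      have "ennreal (Z n k w) \<le> (\<Sum>k. ennreal (Z n k w))"
        using sum_le_suminf[of "\<lambda>k. ennreal (Z n k w)" "{k}"] by simp
      also have "\<dots> \<le> (\<Sum>n. \<Sum>k. ennreal (Z n k w))"
        using sum_le_suminf[of "\<lambda>n. \<Sum>k. ennreal (Z n k w)" "{n}"] by simp
      finally show ?thesis using T by (simp add: ennreal_le_iff)
    qed
    have Y_le: "Y j k w \<le> T" for j k
      using Z_le[of "nat \<bar>j\<bar>" k] Y_nonneg[of j k w] Y_nonneg[of "-j" k w]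
      by (cases "j \<ge> 0") (auto simp: Z_def)
    \<comment> \<open>Every term of the convergent double series is at most its value
      \<open>T\<close>; taking \<open>p\<close>-th roots gives the constant
      \<open>T powr (1 / p)\<close>.\<close>
    have "(\<Prod>i<k. r (j - int i) w) \<le> T powr (1 / p) * \<beta> ^ k * (1 + real_of_int \<bar>j\<bar>) powr a" for j k
    proof -
      let ?\<Pi> = "\<Prod>i<k. r (j - int i) w"
      have "?\<Pi> \<ge> 0" using nonneg by (intro prod_nonneg) auto
      have "?\<Pi> powr p = (\<Prod>i<k. r (j - int i) w powr p)"
        by (intro prod_powr_distrib nonneg)
      also have "\<dots> \<le> T * (\<beta> powr p) ^ k * D j"
        using Y_le[of j k] D[of j] \<open>\<beta> > 0\<close> by (simp add: Y_def field_simps)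
      finally have "(?\<Pi> powr p) powr (1 / p) \<le> (T * (\<beta> powr p) ^ k * D j) powr (1 / p)"
        using \<open>p > 0\<close> by (intro powr_mono2) auto
      also have "(?\<Pi> powr p) powr (1 / p) = ?\<Pi>"
        using \<open>p > 0\<close> \<open>?\<Pi> \<ge> 0\<close> by (simp add: powr_powr)
      also have "(T * (\<beta> powr p) ^ k * D j) powr (1 / p)
          = T powr (1 / p) * ((\<beta> powr p) ^ k) powr (1 / p) * D j powr (1 / p)"
        using T(1) D[of j] by (simp add: powr_mult)
      also have "((\<beta> powr p) ^ k) powr (1 / p) = \<beta> ^ k"
        using \<open>\<beta> > 0\<close> \<open>p > 0\<close> by (simp add: powr_powr powr_realpow flip: powr_realpow)
      also have "D j powr (1 / p) = (1 + real_of_int \<bar>j\<bar>) powr a"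
        using \<open>p > 0\<close> by (simp add: D_def powr_powr)
      finally show ?thesis .
    qed
    then show ?case by blast
  qed
qed

text \<open>Each term of the series splits into two products of ratios at distinct sites, so its
  mean is geometric in \<open>k\<close>. At \<open>\<kappa> = 0\<close> the bound
  \<open>\<mu>\<close> is \<open>(1 + m) / (1 - m)\<close> with \<open>m\<close> the mean ratio, the
  reciprocal of the speed.\<close>

lemma crossing_time_expectation:
  fixes \<kappa> defines "\<mu> \<equiv> (1 + expectation (r 0)) / (1 - (1 + \<kappa>) * expectation (r 0))"
  assumes "\<kappa> \<ge> 0" "(1 + \<kappa>) * expectation (r 0) < 1"
  shows "integrable M (\<lambda>w. crossing_time \<kappa> N (\<lambda>i. r i w) j)"
    and "expectation (\<lambda>w. crossing_time \<kappa> N (\<lambda>i. r i w) j) \<le> \<mu>"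
proof -
  let ?m = "expectation (r 0)"
  have m: "?m \<ge> 0" using nonneg by (intro integral_nonneg_AE) auto
  note prod = expectation_prod[of "\<lambda>x. x", OF _ integrable_r, simplified]
  have term_eq: "(1 + r (j - int k) w) * (\<Prod>i<k. r (j - int i) w)
      = (\<Prod>i<k. r (j - int i) w) + (\<Prod>i<Suc k. r (j - int i) w)" for k w
    by (simp add: algebra_simps)
  have int: "integrable M (\<lambda>w. (1 + r (j - int k) w) * (\<Prod>i<k. r (j - int i) w))" for k
    unfolding term_eq using prod(1) by (intro Bochner_Integration.integrable_add)
  have E: "expectation (\<lambda>w. (1 + r (j - int k) w) * (\<Prod>i<k. r (j - int i) w)) = (1 + ?m) * ?m ^ k" for k
    unfolding term_eq
    by (subst Bochner_Integration.integral_add)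
       (simp_all add: prod del: prod.lessThan_Suc, simp add: distrib_right)
  show "integrable M (\<lambda>w. crossing_time \<kappa> N (\<lambda>i. r i w) j)"
    unfolding crossing_time_def using int by (intro Bochner_Integration.integrable_sum integrable_mult_right)
  have "expectation (\<lambda>w. crossing_time \<kappa> N (\<lambda>i. r i w) j) = (\<Sum>k<N. (1 + \<kappa>) ^ k * ((1 + ?m) * ?m ^ k))"
    unfolding crossing_time_def using int by (simp add: E)
  also have "\<dots> = (1 + ?m) * (\<Sum>k<N. ((1 + \<kappa>) * ?m) ^ k)"
    by (simp add: sum_distrib_left power_mult_distrib mult_ac)
  also have "(\<Sum>k<N. ((1 + \<kappa>) * ?m) ^ k) \<le> (\<Sum>k. ((1 + \<kappa>) * ?m) ^ k)"
    using assms m by (intro sum_le_suminf summable_geometric) auto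
  also have "\<dots> = 1 / (1 - (1 + \<kappa>) * ?m)"
    using assms m by (intro suminf_geometric) auto
  finally show "expectation (\<lambda>w. crossing_time \<kappa> N (\<lambda>i. r i w) j) \<le> \<mu>"
    using m by (simp add: \<mu>_def mult_left_mono)
qed

text \<open>Each variable is a function of the ratios in its own window of \<open>N\<close> sites,
  and functions of disjoint families of independent variables are independent.\<close>

lemma crossing_time_indep:
  assumes "f \<in> borel_measurable borel"
    and disj: "disjoint_family_on (\<lambda>i. {z i - int N<..z i}) I"
  shows "indep_vars (\<lambda>_. borel) (\<lambda>i w. f (crossing_time \<kappa> N (\<lambda>l. r l w) (z i))) I"
proof -
  let ?K = "\<lambda>i. {z i - int N<..z i}"
  have "indep_vars (\<lambda>_. borel)
      (\<lambda>i w. f (crossing_time \<kappa> N (restrict (\<lambda>l. r l w) (?K i)) (z i))) I"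
  proof (rule indep_vars_compose2[OF indep_vars_restrict[OF indep _ disj]])
    fix i
    show "(\<lambda>x. f (crossing_time \<kappa> N x (z i))) \<in> borel_measurable (PiM (?K i) (\<lambda>_. borel))"
      by (rule measurable_compose[OF crossing_time_measurable assms(1)]) auto
  qed auto
  moreover have "crossing_time \<kappa> N (restrict (\<lambda>l. r l w) (?K i)) (z i)
      = crossing_time \<kappa> N (\<lambda>l. r l w) (z i)" for i w
    by (rule crossing_time_cong) auto
  ultimately show ?thesis by simp
qed

text \<open>Truncated crossing times of sites that are congruent modulo \<open>N\<close> are independent; Jensen's
  inequality for \<open>exp\<close> combines the \<open>N\<close> residue classes.\<close>

lemma crossing_time_concentration:
  fixes \<kappa> \<eta> L b :: real and N t :: nat and y :: int
  defines "\<mu> \<equiv> (1 + expectation (r 0)) / (1 - (1 + \<kappa>) * expectation (r 0))"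
  assumes \<kappa>: "\<kappa> \<ge> 0" "(1 + \<kappa>) * expectation (r 0) < 1"
    and "N \<ge> 1" "L > 0" and \<eta>: "0 < \<eta>" "\<eta> \<le> 1"
  shows "\<P>(w in M. b * real (N * t) \<le>
      (\<Sum>i<N * t. min (crossing_time \<kappa> N (\<lambda>l. r l w) (y + int i)) L))
    \<le> exp (- (\<eta> * real t * (b - (1 + \<eta>) * \<mu>) / L))"
proof -
  define X where "X j w = min (crossing_time \<kappa> N (\<lambda>l. r l w) j) L" for j w
  \<comment> \<open>With this scale \<open>\<phi> * X j w\<close> stays in
    \<open>{0..\<eta>}\<close>, hence below 1, where \<open>exp\<close> has a quadratic upper
    bound.\<close>
  define \<phi> where "\<phi> = \<eta> / L"
  have "\<phi> > 0" using assms by (simp add: \<phi>_def)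
  have X: "0 \<le> X j w" "X j w \<le> L" for j w
    using crossing_time_nonneg[of \<kappa> "\<lambda>l. r l w" N j] nonneg \<open>L > 0\<close> \<kappa> by (auto simp: X_def)
  note ct_int = crossing_time_expectation(1)[OF \<kappa>]
  have [measurable]: "(\<lambda>w. crossing_time \<kappa> N (\<lambda>l. r l w) j) \<in> borel_measurable M" for j
    using ct_int by auto
  have [measurable]: "X j \<in> borel_measurable M" for j
    unfolding X_def[abs_def] by measurable
  have X_int: "integrable M (X j)" for j
    by (rule integrable_const_bound[where B = L]) (auto simp: X)
  have EX: "expectation (X j) \<le> \<mu>" for j
  proof -
    have "expectation (X j) \<le> expectation (\<lambda>w. crossing_time \<kappa> N (\<lambda>l. r l w) j)"
      by (intro integral_mono X_int ct_int) (auto simp: X_def)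
    also have "\<dots> \<le> \<mu>" unfolding \<mu>_def by (rule crossing_time_expectation(2)[OF \<kappa>])
    finally show ?thesis .
  qed
  define Z where "Z j w = exp (\<phi> * X j w)" for j w
  have [measurable]: "Z j \<in> borel_measurable M" for j
    unfolding Z_def[abs_def] by measurable
  have \<phi>X: "\<phi> * X j w \<le> \<eta>" for j w
    using mult_left_mono[OF X(2)[of j w], of \<phi>] \<open>\<phi> > 0\<close> \<open>L > 0\<close> by (simp add: \<phi>_def)
  have Z_le: "Z j w \<le> exp \<eta>" for j w
    using \<phi>X by (simp add: Z_def)
  have Z_int: "integrable M (Z j)" for j
    by (rule integrable_const_bound[where B = "exp \<eta>"]) (auto simp: Z_def \<phi>X)
  have EZ: "expectation (Z j) \<le> exp (\<phi> * (1 + \<eta>) * \<mu>)" for j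
  proof -
    \<comment> \<open>The quadratic term is at most \<open>\<eta>\<close> times the linear one, so
      that only the mean of \<open>X\<close>, and not its variance, enters.\<close>
    have "Z j w \<le> 1 + \<phi> * (1 + \<eta>) * X j w" for w
    proof -
      have "Z j w \<le> 1 + \<phi> * X j w + (\<phi> * X j w)\<^sup>2"
        unfolding Z_def using \<phi>X[of j w] \<eta> X(1)[of j w] \<open>\<phi> > 0\<close> by (intro exp_bound) auto
      also have "(\<phi> * X j w)\<^sup>2 \<le> \<eta> * (\<phi> * X j w)"
        unfolding power2_eq_square using \<phi>X[of j w] X(1)[of j w] \<open>\<phi> > 0\<close> by (intro mult_right_mono) auto
      finally show ?thesis by (simp add: algebra_simps)
    qed
    then have "expectation (Z j) \<le> expectation (\<lambda>w. 1 + \<phi> * (1 + \<eta>) * X j w)"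
      using X_int Z_int by (intro integral_mono) auto
    also have "\<dots> = 1 + \<phi> * (1 + \<eta>) * expectation (X j)"
      using X_int by (simp add: prob_space)
    also have "\<dots> \<le> 1 + \<phi> * (1 + \<eta>) * \<mu>"
      using EX[of j] \<open>\<phi> > 0\<close> \<eta> by (intro add_left_mono mult_left_mono) auto
    also have "\<dots> \<le> exp (\<phi> * (1 + \<eta>) * \<mu>)" by (rule exp_ge_add_one_self)
    finally show ?thesis .
  qed
  have EZ_nonneg: "expectation (Z j) \<ge> 0" for j
    by (intro integral_nonneg_AE) (auto simp: Z_def)
  \<comment> \<open>The exponential of the sum over one residue class modulo \<open>N\<close>; its
    \<open>t\<close> factors are independent because consecutive windows of length \<open>N\<close>
    do not overlap.\<close>
  define W where "W c w = (\<Prod>i<t. Z (y + int (c + i * N)) w)" for c w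
  have ind: "indep_vars (\<lambda>_. borel) (\<lambda>i. Z (y + int (c + i * N))) {..<t}" for c
  proof -
    have "disjoint_family_on (\<lambda>i. {y + int (c + i * N) - int N<..y + int (c + i * N)}) {..<t}"
      unfolding disjoint_family_on_def
    proof (intro ballI impI)
      fix i k :: nat assume "i \<noteq> k"
      then consider "Suc i \<le> k" | "Suc k \<le> i" by linarith
      then have "Suc i * N \<le> k * N \<or> Suc k * N \<le> i * N"
        by cases (blast intro: mult_le_mono1)+
      then have "int (i * N) + int N \<le> int (k * N) \<or> int (k * N) + int N \<le> int (i * N)"
        by (simp add: add.commute del: of_nat_mult flip: of_nat_add)
      then show "{y + int (c + i * N) - int N<..y + int (c + i * N)}
          \<inter> {y + int (c + k * N) - int N<..y + int (c + k * N)} = {}"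
        by auto
    qed
    from crossing_time_indep[OF _ this, of "\<lambda>x. exp (\<phi> * min x L)"] show ?thesis
      unfolding Z_def[abs_def] X_def[abs_def] by simp
  qed
  have W_int: "integrable M (W c)" for c
    unfolding W_def[abs_def] by (rule indep_vars_integrable[OF _ ind]) (auto intro: Z_int)
  have EW: "expectation (W c) \<le> exp (real t * (\<phi> * (1 + \<eta>) * \<mu>))" for c
  proof -
    have "expectation (W c) = (\<Prod>i<t. expectation (Z (y + int (c + i * N))))"
      unfolding W_def[abs_def] by (rule indep_vars_lebesgue_integral[OF _ ind]) (auto intro: Z_int)
    also have "\<dots> \<le> (\<Prod>i<t. exp (\<phi> * (1 + \<eta>) * \<mu>))"
      by (intro prod_mono conjI EZ EZ_nonneg)
    finally show ?thesis by (simp flip: exp_of_nat_mult)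
  qed
  define V where "V w = (\<Sum>c<N. (1 / real N) * W c w)" for w
  have V_int: "integrable M V"
    unfolding V_def[abs_def] using W_int by (intro Bochner_Integration.integrable_sum integrable_mult_right)
  have EV: "expectation V \<le> exp (real t * (\<phi> * (1 + \<eta>) * \<mu>))"
  proof -
    have "expectation V = (\<Sum>c<N. (1 / real N) * expectation (W c))"
      unfolding V_def[abs_def] using W_int by simp
    also have "\<dots> \<le> (\<Sum>c<N. (1 / real N) * exp (real t * (\<phi> * (1 + \<eta>) * \<mu>)))"
      using EW by (intro sum_mono mult_left_mono) auto
    finally show ?thesis using \<open>N \<ge> 1\<close> by simp
  qed
  \<comment> \<open>The full sum is \<open>N\<close> times the average of the class sums
    \<open>T c\<close>; convexity bounds the exponential of that average by the average
    \<open>V\<close> of the exponentials.\<close>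
  have V_ge: "exp (\<phi> * b * real t) \<le> V w"
    if "b * real (N * t) \<le> (\<Sum>i<N * t. X (y + int i) w)" for w
  proof -
    define T where "T c = (\<Sum>i<t. X (y + int (c + i * N)) w)" for c
    have "(\<Sum>i<N * t. X (y + int i) w) = (\<Sum>i<t. \<Sum>m\<in>{i * N..<i * N + N}. X (y + int m) w)"
      by (subst sum.nat_group) (simp add: mult.commute)
    also have "\<dots> = (\<Sum>i<t. \<Sum>c<N. X (y + int (c + i * N)) w)"
    proof (rule sum.cong[OF refl])
      fix i :: nat
      show "(\<Sum>m\<in>{i * N..<i * N + N}. X (y + int m) w) = (\<Sum>c<N. X (y + int (c + i * N)) w)"
        by (rule sum.reindex_bij_witness[of _ "\<lambda>c. c + i * N" "\<lambda>m. m - i * N"]) auto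
    qed
    also have "\<dots> = (\<Sum>c<N. T c)"
      unfolding T_def by (rule sum.swap)
    finally have "b * real N * real t \<le> (\<Sum>c<N. T c)" using that by simp
    then have "b * real t \<le> (\<Sum>c<N. T c) / real N"
      using \<open>N \<ge> 1\<close> by (simp add: field_simps)
    then have "\<phi> * (b * real t) \<le> \<phi> * ((\<Sum>c<N. T c) / real N)"
      using \<open>\<phi> > 0\<close> by (intro mult_left_mono) auto
    also have "\<dots> = (\<Sum>c<N. (1 / real N) *\<^sub>R (\<phi> * T c))"
      by (simp add: sum_distrib_left sum_divide_distrib)
    finally have "exp (\<phi> * b * real t) \<le> exp (\<Sum>c<N. (1 / real N) *\<^sub>R (\<phi> * T c))"
      by (simp add: mult.assoc)
    also have "\<dots> \<le> (\<Sum>c<N. (1 / real N) * exp (\<phi> * T c))"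
      using \<open>N \<ge> 1\<close> by (intro convex_on_sum[OF _ _ exp_convex]) (auto simp: lessThan_empty_iff)
    also have "\<dots> = V w"
      unfolding V_def W_def T_def Z_def by (simp add: sum_distrib_left exp_sum)
    finally show ?thesis .
  qed
  have "\<P>(w in M. b * real (N * t) \<le> (\<Sum>i<N * t. X (y + int i) w))
      \<le> \<P>(w in M. exp (\<phi> * b * real t) \<le> V w)"
    using V_ge V_int by (intro finite_measure_mono) auto
  also have "\<dots> \<le> expectation V / exp (\<phi> * b * real t)"
  proof (rule integral_Markov_inequality_measure[OF V_int])
    have "V w \<ge> 0" for w
      by (auto simp: V_def W_def Z_def intro!: sum_nonneg divide_nonneg_nonneg prod_nonneg)
    then show "AE w in M. 0 \<le> V w" by simp
  qed auto
  also have "\<dots> \<le> exp (real t * (\<phi> * (1 + \<eta>) * \<mu>)) / exp (\<phi> * b * real t)"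
    by (intro divide_right_mono EV) auto
  also have "\<dots> = exp (- (\<eta> * real t * (b - (1 + \<eta>) * \<mu>) / L))"
    using \<open>L > 0\<close> by (simp add: \<phi>_def field_simps flip: exp_diff)
  finally show ?thesis unfolding X_def .
qed

end

section \<open>Sums of crossing times along the environment\<close>

text \<open>Of order \<open>n powr \<tau>\<close>: deep enough for geometric decay to beat every
  power of \<open>n\<close>, yet negligible against \<open>n\<close> when \<open>\<tau> < 1\<close>.
  The successor keeps it positive and matches the form \<open>Suc N\<close> of the
  supersolution.\<close>

definition depth :: "real \<Rightarrow> nat \<Rightarrow> nat" where
  "depth \<tau> n = Suc (nat \<lceil>real n powr \<tau>\<rceil>)"

text \<open>For \<open>v > 0\<close>, the least number of blocks of \<open>depth \<tau> n\<close>
  sites that cover a stretch of length \<open>n * v\<close>; the concentration bound needs whole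
  blocks.\<close>

definition num_blocks :: "real \<Rightarrow> real \<Rightarrow> nat \<Rightarrow> nat" where
  "num_blocks \<tau> v n = nat \<lceil>real n * v / real (depth \<tau> n)\<rceil>"

lemma depth_pos [simp]: "0 < depth \<tau> n"
  by (simp add: depth_def)

lemma depth_le: "real (depth \<tau> n) \<le> real n powr \<tau> + 2"
  unfolding depth_def using of_int_ceiling_le_add_one[of "real n powr \<tau>"] by (simp add: add.commute)

lemma num_blocks_ge: "real n * v / real (depth \<tau> n) \<le> real (num_blocks \<tau> v n)"
  unfolding num_blocks_def by linarith

lemma depth_num_blocks:
  assumes "v > 0"
  shows "real n * v \<le> real (depth \<tau> n * num_blocks \<tau> v n)"
    and "real (depth \<tau> n * num_blocks \<tau> v n) \<le> real n * v + real (depth \<tau> n)"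
proof -
  have pos: "real (depth \<tau> n) > 0" by simp
  show "real n * v \<le> real (depth \<tau> n * num_blocks \<tau> v n)"
    using num_blocks_ge[of n v \<tau>] pos by (simp add: field_simps)
  have "0 \<le> real n * v / real (depth \<tau> n)" using assms by simp
  then have "real (num_blocks \<tau> v n) \<le> real n * v / real (depth \<tau> n) + 1"
    unfolding num_blocks_def by linarith
  then show "real (depth \<tau> n * num_blocks \<tau> v n) \<le> real n * v + real (depth \<tau> n)"
    using pos by (simp add: field_simps)
qed

definition starts :: "real \<Rightarrow> real \<Rightarrow> nat \<Rightarrow> int set" where
  "starts A B n = {\<lfloor>A * real n\<rfloor><..\<lfloor>B * real n\<rfloor>}"

lemma mem_starts: "y \<in> starts A B n \<longleftrightarrow> A * real n < real_of_int y \<and> real_of_int y \<le> B * real n"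
  unfolding starts_def by (auto simp: floor_less_iff le_floor_iff)

lemma finite_starts [simp]: "finite (starts A B n)"
  by (simp add: starts_def)

lemma card_starts: "A \<le> B \<Longrightarrow> real (card (starts A B n)) \<le> (B - A) * real n + 1"
proof -
  assume "A \<le> B"
  then have "A * real n \<le> B * real n" by (intro mult_right_mono) auto
  then show ?thesis
    unfolding starts_def by (simp add: algebra_simps) linarith
qed

text \<open>Concentration at level \<open>n powr (\<sigma> + 2 * \<tau>)\<close>, a union bound over
  the linearly many starting sites, and Borel-Cantelli.\<close>

lemma (in bounded_iid) AE_crossing_time_sums:
  fixes \<kappa> b v A B \<sigma> \<tau> :: real
  assumes \<kappa>: "\<kappa> \<ge> 0" "(1 + \<kappa>) * expectation (r 0) < 1"
    and b: "(1 + expectation (r 0)) / (1 - (1 + \<kappa>) * expectation (r 0)) < b"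
    and "v > 0" "A \<le> B" "\<tau> > 0" "\<sigma> + 3 * \<tau> < 1"
  shows "AE w in M. \<forall>\<^sub>F n in sequentially. \<forall>y\<in>starts A B n.
    (\<Sum>i<depth \<tau> n * num_blocks \<tau> v n.
      min (crossing_time \<kappa> (depth \<tau> n) (\<lambda>l. r l w) (y + int i)) (real n powr (\<sigma> + 2 * \<tau>)))
    \<le> b * real (depth \<tau> n * num_blocks \<tau> v n)"
proof -
  define \<mu> where "\<mu> = (1 + expectation (r 0)) / (1 - (1 + \<kappa>) * expectation (r 0))"
  have "expectation (r 0) \<ge> 0" using nonneg by (intro integral_nonneg_AE) auto
  then have \<mu>: "\<mu> > 0" using \<kappa> by (auto simp: \<mu>_def intro!: divide_pos_pos)
  \<comment> \<open>Small enough that \<open>(1 + \<eta>) * \<mu>\<close> remains strictly below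
    \<open>b\<close>.\<close>
  define \<eta> where "\<eta> = min 1 ((b - \<mu>) / (2 * \<mu>))"
  have "\<mu> < b" using b by (simp add: \<mu>_def)
  then have \<eta>: "0 < \<eta>" "\<eta> \<le> 1" using \<mu> by (auto simp: \<eta>_def)
  have "\<eta> * \<mu> \<le> (b - \<mu>) / (2 * \<mu>) * \<mu>"
    using \<mu> by (intro mult_right_mono) (auto simp: \<eta>_def)
  also have "\<dots> < b - \<mu>" using \<mu> \<open>\<mu> < b\<close> by simp
  finally have gap: "b - (1 + \<eta>) * \<mu> > 0" by (simp add: algebra_simps)
  define d where "d = \<eta> * v * (b - (1 + \<eta>) * \<mu>) / 3"
  have "d > 0" using \<eta> gap \<open>v > 0\<close> by (simp add: d_def)
  \<comment> \<open>The order of the exponent: about \<open>n powr (1 - \<tau>)\<close> blocks,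
    divided by the truncation level.\<close>
  define e where "e = 1 - \<sigma> - 3 * \<tau>"
  have "e > 0" using assms by (simp add: e_def)
  let ?S = "\<lambda>n y w. \<Sum>i<depth \<tau> n * num_blocks \<tau> v n.
    min (crossing_time \<kappa> (depth \<tau> n) (\<lambda>l. r l w) (y + int i)) (real n powr (\<sigma> + 2 * \<tau>))"
  let ?b = "\<lambda>n. b * real (depth \<tau> n * num_blocks \<tau> v n)"
  have [measurable]: "(\<lambda>w. crossing_time \<kappa> N (\<lambda>l. r l w) j) \<in> borel_measurable M" for N j
    using crossing_time_expectation(1)[OF \<kappa>] by auto
  define bad where "bad n = (\<Union>y\<in>starts A B n. {w \<in> space M. ?b n \<le> ?S n y w})" for n
  have [measurable]: "bad n \<in> sets M" for n
    unfolding bad_def by measurable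
  have bound: "prob (bad n) \<le> ((B - A) * real n + 1) * exp (- (d * real n powr e))" if "n \<ge> 1" for n
  proof -
    have "d * real n powr e \<le> \<eta> * real (num_blocks \<tau> v n) * (b - (1 + \<eta>) * \<mu>) / real n powr (\<sigma> + 2 * \<tau>)"
    proof -
      have "real n powr \<tau> \<ge> 1" using that \<open>\<tau> > 0\<close> by (simp add: ge_one_powr_ge_zero)
      then have "real (depth \<tau> n) \<le> 3 * real n powr \<tau>" using depth_le[of \<tau> n] by simp
      then have "real n * v / (3 * real n powr \<tau>) \<le> real n * v / real (depth \<tau> n)"
        using that \<open>v > 0\<close> by (intro divide_left_mono) auto
      also note num_blocks_ge
      finally have "real n * v / (3 * real n powr \<tau>) * (\<eta> * (b - (1 + \<eta>) * \<mu>) / real n powr (\<sigma> + 2 * \<tau>))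
          \<le> real (num_blocks \<tau> v n) * (\<eta> * (b - (1 + \<eta>) * \<mu>) / real n powr (\<sigma> + 2 * \<tau>))"
        using \<eta> gap by (intro mult_right_mono) auto
      moreover have "real n powr e = real n / (real n powr \<tau> * real n powr (\<sigma> + 2 * \<tau>))"
        using that by (simp add: e_def powr_diff powr_add[symmetric] algebra_simps flip: powr_add)
      ultimately show ?thesis by (simp add: d_def mult_ac)
    qed
    then have *: "exp (- (\<eta> * real (num_blocks \<tau> v n) * (b - (1 + \<eta>) * \<mu>) / real n powr (\<sigma> + 2 * \<tau>)))
        \<le> exp (- (d * real n powr e))"
      by simp
    have "prob (bad n) \<le> (\<Sum>y\<in>starts A B n. \<P>(w in M. ?b n \<le> ?S n y w))"
      unfolding bad_def by (intro finite_measure_subadditive_finite) auto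
    also have "\<dots> \<le> (\<Sum>y\<in>starts A B n. exp (- (d * real n powr e)))"
      using that \<eta> unfolding \<mu>_def
      by (intro sum_mono order_trans[OF crossing_time_concentration[OF \<kappa>, of _ _ \<eta>] *[unfolded \<mu>_def]])
         (auto simp: Suc_le_eq)
    also have "\<dots> \<le> ((B - A) * real n + 1) * exp (- (d * real n powr e))"
      using card_starts[OF \<open>A \<le> B\<close>, of n] by (simp add: mult_right_mono)
    finally show ?thesis .
  qed
  have "summable (\<lambda>n. prob (bad n))"
  proof (rule summable_comparison_test_ev)
    define D where "D = B - A"
    have "D \<ge> 0" using \<open>A \<le> B\<close> by (simp add: D_def)
    have "((\<lambda>n. real n powr 2 * ((D * real n + 1) * exp (- (d * real n powr e)))) \<longlongrightarrow> 0) sequentially"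
      using \<open>d > 0\<close> \<open>e > 0\<close> \<open>D \<ge> 0\<close>
      by (cases "D = 0") (simp, real_asymp, (subgoal_tac "D > 0", real_asymp, simp))
    then have "\<forall>\<^sub>F n in sequentially. real n powr 2 * ((D * real n + 1) * exp (- (d * real n powr e))) < 1"
      by (rule order_tendstoD) simp
    then show "\<forall>\<^sub>F n in sequentially. norm (prob (bad n)) \<le> real n powr (-2)"
      using eventually_ge_at_top[of 1]
    proof eventually_elim
      case (elim n)
      have "(D * real n + 1) * exp (- (d * real n powr e)) \<le> real n powr (-2)"
        using elim by (simp add: powr_minus_divide field_simps)
      with bound[of n] elim show ?case by (simp add: D_def)
    qed
    show "summable (\<lambda>n. real n powr (-2))"
      by (simp add: summable_real_powr_iff)
  qed
  then have "AE w in M. \<forall>\<^sub>F n in sequentially. w \<in> space M - bad n"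
    by (intro borel_cantelli_AE1) (auto simp: emeasure_eq_measure)
  then show ?thesis
  proof eventually_elim
    case (elim w)
    then show ?case
      by eventually_elim (auto simp: bad_def not_le intro: less_imp_le)
  qed
qed

section \<open>Quenched slowdown\<close>

text \<open>The rate is \<open>l = n powr (- (\<sigma> + 4 * \<tau>))\<close>. Crossing times at the
  relevant sites are at most \<open>n powr (\<sigma> + 2 * \<tau>)\<close>, so \<open>g\<close> is
  of order \<open>n powr (- 2 * \<tau>)\<close> and the supersolution applies. The sum of
  \<open>g\<close> over the \<open>m\<close> sites is at most about
  \<open>(1 + \<kappa>) * b * v * l * n\<close>, which leaves a fixed fraction of
  \<open>l * n\<close>.\<close>

lemma iter_step_slowdown:
  fixes \<omega> :: "int \<Rightarrow> real" and \<kappa> \<beta> \<sigma> \<tau> v b A B C R :: real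
  assumes \<omega>: "\<And>j. 0 < \<omega> j" "\<And>j. \<omega> j \<le> 1" and R: "\<And>j. rho \<omega> j \<le> R"
    and "\<kappa> > 0" "\<beta> > 0" "(1 + \<kappa>) * \<beta> < 1"
    and "\<sigma> > 0" "\<tau> > 0" "\<sigma> + 4 * \<tau> < 1" "v > 0" "b > 0" "(1 + \<kappa>) * b * v < 1"
    and growth: "\<And>j k. (\<Prod>i<k. rho \<omega> (j - int i)) \<le> C * \<beta> ^ k * (1 + real_of_int \<bar>j\<bar>) powr (\<sigma> + \<tau>)"
    and sums: "\<forall>\<^sub>F n in sequentially. \<forall>y\<in>starts A B n.
      (\<Sum>i<depth \<tau> n * num_blocks \<tau> v n.
        min (crossing_time \<kappa> (depth \<tau> n) (rho \<omega>) (y + int i)) (real n powr (\<sigma> + 2 * \<tau>)))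
      \<le> b * real (depth \<tau> n * num_blocks \<tau> v n)"
  shows "\<forall>\<^sub>F n in sequentially. \<forall>y\<in>starts A B n.
    iter_step \<omega> {..y + int (depth \<tau> n * num_blocks \<tau> v n)} n y
      \<le> exp (- ((1 - (1 + \<kappa>) * b * v) / 2 * real n powr (1 - \<sigma> - 4 * \<tau>)))"
proof -
  \<comment> \<open>Half of the available gap; the other half absorbs the rounding of
    \<open>n * v\<close> up to whole blocks.\<close>
  define \<epsilon> where "\<epsilon> = (1 - (1 + \<kappa>) * b * v) / 2"
  have "\<epsilon> > 0" using assms by (simp add: \<epsilon>_def)
  have rho: "rho \<omega> j \<ge> 0" for j
    using \<omega>[of j] by (simp add: rho_def)
  have "C \<ge> 0" using growth[where j = 0 and k = 0] by simp
  have "R \<ge> 0" using rho[of 0] R[of 0] by linarith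
  \<comment> \<open>All sites used lie within \<open>K * n\<close> of the origin: the starts, their
    neighbourhoods of radius \<open>n + 1\<close>, and the \<open>m \<le> n * v + n + 2\<close>
    sites to the right of a start.\<close>
  define K where "K = \<bar>A\<bar> + \<bar>B\<bar> + v + 6"
  have "K > 0" using \<open>v > 0\<close> by (simp add: K_def)
  define x where "x = (1 + \<kappa>) * \<beta>"
  have x: "0 < x" "x < 1" using assms by (auto simp: x_def)
  define E where "E = (1 + R) * (C * K powr (\<sigma> + \<tau>))"
  have "E \<ge> 0" using \<open>R \<ge> 0\<close> \<open>C \<ge> 0\<close> by (simp add: E_def)
  define \<theta> where "\<theta> = \<kappa> / (2 * (1 + \<kappa>)\<^sup>2)"
  have "\<theta> > 0" using \<open>\<kappa> > 0\<close> by (simp add: \<theta>_def)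
  have 1: "\<forall>\<^sub>F n in sequentially. E / (1 - x) < real n powr \<tau>"
  proof -
    have "filterlim (\<lambda>n. real n powr \<tau>) at_top sequentially"
      using \<open>\<tau> > 0\<close> by real_asymp
    then show ?thesis by (simp add: filterlim_at_top_dense)
  qed
  \<comment> \<open>The denominator is \<open>E + 1\<close> because \<open>E\<close> may
    vanish.\<close>
  have 2: "\<forall>\<^sub>F n in sequentially. exp (ln x * real n powr \<tau>) * real n powr (\<sigma> + \<tau>) < \<theta> / (E + 1)"
  proof (rule order_tendstoD)
    define \<xi> where "\<xi> = - ln x"
    have "\<xi> > 0" using x by (simp add: \<xi>_def)
    have "((\<lambda>n. exp (- \<xi> * real n powr \<tau>) * real n powr (\<sigma> + \<tau>)) \<longlongrightarrow> 0) sequentially"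
      using \<open>\<xi> > 0\<close> \<open>\<tau> > 0\<close> \<open>\<sigma> > 0\<close> by real_asymp
    then show "((\<lambda>n. exp (ln x * real n powr \<tau>) * real n powr (\<sigma> + \<tau>)) \<longlongrightarrow> 0) sequentially"
      by (simp add: \<xi>_def)
  qed (use \<open>\<theta> > 0\<close> \<open>E \<ge> 0\<close> in auto)
  have 3: "\<forall>\<^sub>F n in sequentially. real n powr (- 2 * \<tau>) < \<theta>"
  proof (rule order_tendstoD)
    show "((\<lambda>n. real n powr (- 2 * \<tau>)) \<longlongrightarrow> 0) sequentially"
      using \<open>\<tau> > 0\<close> by real_asymp
  qed fact
  have 4: "\<forall>\<^sub>F n in sequentially. (1 + \<kappa>) * b * (real n powr \<tau> + 2) / real n < \<epsilon>"
  proof (rule order_tendstoD)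
    have "\<tau> < 1" using assms by simp
    then have "((\<lambda>n. (real n powr \<tau> + 2) / real n) \<longlongrightarrow> 0) sequentially"
      using \<open>\<tau> > 0\<close> by real_asymp
    from tendsto_mult_left[OF this, of "(1 + \<kappa>) * b"]
    show "((\<lambda>n. (1 + \<kappa>) * b * (real n powr \<tau> + 2) / real n) \<longlongrightarrow> 0) sequentially"
      by simp
  qed fact
  show ?thesis
    unfolding \<epsilon>_def[symmetric]
    using 1 2 3 4 sums eventually_ge_at_top[of 1]
  proof eventually_elim
    case (elim n)
    then have "n \<ge> 1" by simp
    define m where "m = depth \<tau> n * num_blocks \<tau> v n"
    define N where "N = nat \<lceil>real n powr \<tau>\<rceil>"
    have depth: "depth \<tau> n = Suc N" by (simp add: depth_def N_def)
    define l where "l = real n powr (- (\<sigma> + 4 * \<tau>))"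
    have "l > 0" using \<open>n \<ge> 1\<close> by (simp add: l_def)
    define g where "g j = (1 + \<kappa>) * l * crossing_time \<kappa> (Suc N) (rho \<omega>) j" for j
    have g_nonneg: "g j \<ge> 0" for j
      unfolding g_def using \<open>\<kappa> > 0\<close> \<open>l > 0\<close> rho
      by (intro mult_nonneg_nonneg crossing_time_nonneg) auto
    have m: "real n * v \<le> real m" "real m \<le> real n * v + (real n powr \<tau> + 2)"
      using depth_num_blocks[OF \<open>v > 0\<close>, where n = n and \<tau> = \<tau>] depth_le[where n = n and \<tau> = \<tau>] unfolding m_def by linarith+
    have "real n powr \<tau> \<le> real n powr 1"
      using \<open>n \<ge> 1\<close> assms by (intro powr_mono) auto
    then have m': "real m \<le> real n * v + (real n + 2)"
      using m(2) \<open>n \<ge> 1\<close> by simp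
    have growth': "(\<Prod>i<k. rho \<omega> (j - int i)) \<le> C * (K * real n) powr (\<sigma> + \<tau>) * \<beta> ^ k"
      if "1 + real_of_int \<bar>j\<bar> \<le> K * real n" for j k
    proof -
      have "(1 + real_of_int \<bar>j\<bar>) powr (\<sigma> + \<tau>) \<le> (K * real n) powr (\<sigma> + \<tau>)"
        using that assms by (intro powr_mono2) auto
      then have "C * \<beta> ^ k * (1 + real_of_int \<bar>j\<bar>) powr (\<sigma> + \<tau>) \<le> C * \<beta> ^ k * (K * real n) powr (\<sigma> + \<tau>)"
        using \<open>C \<ge> 0\<close> \<open>\<beta> > 0\<close> by (intro mult_left_mono) auto
      with growth[where j = j and k = k] show ?thesis by (simp add: mult_ac)
    qed
    have E_eq: "(1 + R) * (C * (K * real n) powr (\<sigma> + \<tau>)) = E * real n powr (\<sigma> + \<tau>)"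
      by (simp add: E_def powr_mult)
    have ct_le: "crossing_time \<kappa> (Suc N) (rho \<omega>) j \<le> real n powr (\<sigma> + 2 * \<tau>)"
      if "1 + real_of_int \<bar>j\<bar> \<le> K * real n" for j
    proof -
      have "crossing_time \<kappa> (Suc N) (rho \<omega>) j
          \<le> (1 + R) * (C * (K * real n) powr (\<sigma> + \<tau>)) / (1 - (1 + \<kappa>) * \<beta>)"
        using assms rho growth'[OF that] by (intro crossing_time_le) auto
      also have "\<dots> = E / (1 - x) * real n powr (\<sigma> + \<tau>)"
        unfolding E_eq x_def by simp
      also have "\<dots> \<le> real n powr \<tau> * real n powr (\<sigma> + \<tau>)"
        using elim(1) by (intro mult_right_mono) auto
      also have "\<dots> = real n powr (\<sigma> + 2 * \<tau>)"
        unfolding powr_add[symmetric] by (simp add: algebra_simps)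
      finally show ?thesis .
    qed
    have g_small: "g j \<le> \<kappa> / (2 * (1 + \<kappa>))" if "1 + real_of_int \<bar>j\<bar> \<le> K * real n" for j
    proof -
      have "g j \<le> (1 + \<kappa>) * l * real n powr (\<sigma> + 2 * \<tau>)"
        unfolding g_def using ct_le[OF that] \<open>\<kappa> > 0\<close> \<open>l > 0\<close> by (intro mult_left_mono) auto
      also have "\<dots> = (1 + \<kappa>) * real n powr (- 2 * \<tau>)"
        by (simp add: l_def flip: powr_add)
      also have "\<dots> \<le> (1 + \<kappa>) * \<theta>"
        using elim(3) \<open>\<kappa> > 0\<close> by (intro mult_left_mono) auto
      also have "\<dots> = \<kappa> / (2 * (1 + \<kappa>))"
        using \<open>\<kappa> > 0\<close> by (simp add: \<theta>_def power2_eq_square)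
      finally show ?thesis .
    qed
    have last_small: "(1 + \<kappa>) ^ N * ((1 + rho \<omega> (j - int N)) * (\<Prod>i<N. rho \<omega> (j - int i)))
        \<le> \<kappa> / (2 * (1 + \<kappa>)\<^sup>2)" if "1 + real_of_int \<bar>j\<bar> \<le> K * real n" for j
    proof -
      have "(1 + \<kappa>) ^ N * ((1 + rho \<omega> (j - int N)) * (\<Prod>i<N. rho \<omega> (j - int i)))
          \<le> (1 + \<kappa>) ^ N * ((1 + R) * (C * (K * real n) powr (\<sigma> + \<tau>) * \<beta> ^ N))"
        using growth'[OF that] R rho \<open>R \<ge> 0\<close> \<open>\<kappa> > 0\<close>
        by (intro mult_left_mono mult_mono prod_nonneg) auto
      also have "\<dots> = x ^ N * ((1 + R) * (C * (K * real n) powr (\<sigma> + \<tau>)))"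
        by (simp add: x_def power_mult_distrib mult_ac)
      also have "\<dots> = E * (x ^ N * real n powr (\<sigma> + \<tau>))"
        unfolding E_eq by simp
      also have "x ^ N \<le> exp (ln x * real n powr \<tau>)"
      proof -
        have "real n powr \<tau> \<le> real N" by (simp add: N_def)
        then have "ln x * real N \<le> ln x * real n powr \<tau>"
          using x by (intro mult_left_mono_neg) auto
        moreover have "x ^ N = exp (ln x * real N)"
          using x by (simp add: exp_of_nat2_mult)
        ultimately show ?thesis by simp
      qed
      also have "E * (exp (ln x * real n powr \<tau>) * real n powr (\<sigma> + \<tau>)) \<le> E * (\<theta> / (E + 1))"
        using elim(2) \<open>E \<ge> 0\<close> by (intro mult_left_mono) auto
      also have "\<dots> \<le> \<theta>"
        using \<open>E \<ge> 0\<close> \<open>\<theta> > 0\<close> by (simp add: field_simps)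
      finally show ?thesis
        using \<open>E \<ge> 0\<close> by (simp add: \<theta>_def mult_left_mono mult_right_mono)
    qed
    show ?case
    proof
      fix y assume y: "y \<in> starts A B n"
      have "\<bar>real_of_int y\<bar> \<le> (\<bar>A\<bar> + \<bar>B\<bar>) * real n"
      proof -
        have "\<bar>A * real n\<bar> = \<bar>A\<bar> * real n" "\<bar>B * real n\<bar> = \<bar>B\<bar> * real n"
          by (simp_all add: abs_mult)
        then show ?thesis using y by (simp add: mem_starts distrib_right) linarith
      qed
      moreover have "K * real n = (\<bar>A\<bar> + \<bar>B\<bar>) * real n + real n * v + 6 * real n"
        by (simp add: K_def algebra_simps)
      ultimately have y_le: "\<bar>real_of_int y\<bar> + real n * v + 6 * real n \<le> K * real n"
        by linarith
      \<comment> \<open>Radius \<open>n + 1\<close> rather than \<open>n\<close>: the condition on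
        the last term is required at \<open>j - 1\<close>.\<close>
      have near: "1 + real_of_int \<bar>j\<bar> \<le> K * real n" if "\<bar>j - y\<bar> \<le> int n + 1" for j
      proof -
        have "real_of_int \<bar>j\<bar> \<le> \<bar>real_of_int y\<bar> + real n + 1" using that by linarith
        moreover have "real n * v \<ge> 0" using \<open>v > 0\<close> by simp
        ultimately show ?thesis using y_le \<open>n \<ge> 1\<close> by linarith
      qed
      have right: "1 + real_of_int \<bar>y + int i\<bar> \<le> K * real n" if "i < m" for i
      proof -
        have "real_of_int \<bar>y + int i\<bar> \<le> \<bar>real_of_int y\<bar> + real m" using that by linarith
        then show ?thesis using y_le m' \<open>n \<ge> 1\<close> by linarith
      qed
      have "iter_step \<omega> {..y + int m} n y \<le> exp (- l * real n + (\<Sum>i<m. g (y + int i)))"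
      proof (rule iter_step_le[OF \<omega> g_nonneg])
        fix j assume j: "\<bar>j - y\<bar> \<le> int n"
        show "(g j)\<^sup>2 + rho \<omega> j * g (j - 1) + l * (1 + rho \<omega> j) \<le> g j"
          unfolding g_def
          using g_small[of j, unfolded g_def] last_small[of "j - 1"] near[of j] near[of "j - 1"] j
            rho \<open>\<kappa> > 0\<close> \<open>l > 0\<close>
          by (intro crossing_time_supersolution) auto
      qed
      also have "- l * real n + (\<Sum>i<m. g (y + int i)) \<le> - \<epsilon> * (l * real n)"
      proof -
        \<comment> \<open>By \<open>ct_le\<close> the cap in the minimum is not active at these
          sites, so the averaged bound for capped crossing times applies to
          \<open>g\<close>.\<close>
        have "(\<Sum>i<m. g (y + int i)) = (1 + \<kappa>) * l * (\<Sum>i<m.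
            min (crossing_time \<kappa> (depth \<tau> n) (rho \<omega>) (y + int i)) (real n powr (\<sigma> + 2 * \<tau>)))"
          unfolding g_def sum_distrib_left[symmetric] depth using ct_le right
          by (intro arg_cong2[where f = "(*)"] sum.cong refl) (simp add: min_def)
        also have "\<dots> \<le> (1 + \<kappa>) * l * (b * real m)"
          using elim(5) y \<open>\<kappa> > 0\<close> \<open>l > 0\<close> unfolding m_def by (intro mult_left_mono) auto
        also have "\<dots> \<le> (1 + \<kappa>) * l * (b * (real n * v + (real n powr \<tau> + 2)))"
          using m(2) \<open>\<kappa> > 0\<close> \<open>l > 0\<close> \<open>b > 0\<close> by (intro mult_left_mono) auto
        also have "\<dots> = l * ((1 + \<kappa>) * b * v * real n + (1 + \<kappa>) * b * (real n powr \<tau> + 2))"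
          by (simp add: algebra_simps)
        also have "\<dots> \<le> l * ((1 + \<kappa>) * b * v * real n + \<epsilon> * real n)"
          using elim(4) \<open>l > 0\<close> \<open>n \<ge> 1\<close> by (intro mult_left_mono add_left_mono) (auto simp: divide_less_eq)
        also have "(1 + \<kappa>) * b * v * real n + \<epsilon> * real n = (1 - \<epsilon>) * real n"
        proof -
          have "z = 1 - 2 * ((1 - z) / 2)" for z :: real
            by (simp add: field_simps)
          then have "(1 + \<kappa>) * b * v = 1 - 2 * \<epsilon>"
            unfolding \<epsilon>_def .
          then show ?thesis by (simp only:) (simp add: algebra_simps)
        qed
        finally show ?thesis by (simp add: algebra_simps)
      qed
      also have "l * real n = real n powr (1 - \<sigma> - 4 * \<tau>)"
      proof -
        have "l * real n = l * real n powr 1" using \<open>n \<ge> 1\<close> by simp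
        also have "\<dots> = real n powr (1 - \<sigma> - 4 * \<tau>)"
          unfolding l_def by (simp only: powr_add[symmetric]) (simp add: algebra_simps)
        finally show ?thesis .
      qed
      finally show "iter_step \<omega> {..y + int (depth \<tau> n * num_blocks \<tau> v n)} n y
          \<le> exp (- (\<epsilon> * real n powr (1 - \<sigma> - 4 * \<tau>)))"
        by (simp add: m_def)
    qed
  qed
qed

section \<open>From the bound for one walk to the logarithmic limit\<close>

lemma elog_mono: "p \<le> q \<Longrightarrow> elog p \<le> elog q"
  by (auto simp: elog_def)

text \<open>Subadditivity over the sites in \<open>S\<close> and the at most \<open>q\<close>
  admissible indices at each, after raising the threshold \<open>a\<close> to the integer
  \<open>m\<close>.\<close>

lemma quenched_walks_union_bound:
  assumes walks: "quenched_walks \<omega> M X" and S: "finite S" and q: "q \<ge> 0" "u \<ge> 0"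
    and bound: "\<And>y. y \<in> S \<Longrightarrow> iter_step \<omega> {..y + int m} n y \<le> u" and m: "a \<le> real m"
  shows "\<P>(w in M. \<exists>y i. y \<in> S \<and> 1 \<le> i \<and> real i \<le> q \<and> real_of_int (X y i n w - y) \<le> a)
    \<le> real (card S) * (q * u)"
proof -
  interpret prob_space M
    using walks by (simp add: quenched_walks_def)
  have chain: "quenched_chain \<omega> M y (X y i)" if "i \<ge> 1" for y i
    using walks that by (simp add: quenched_walks_def)
  then have meas: "X y i n \<in> measurable M (count_space UNIV)" if "i \<ge> 1" for y i
    using that by (simp add: quenched_chain_def)
  let ?I = "{1..nat \<lfloor>q\<rfloor>}"
  let ?E = "\<lambda>y i. {w \<in> space M. X y i n w \<in> {..y + int m}}"
  have E[measurable]: "?E y i \<in> sets M" if "i \<in> ?I" for y i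
  proof -
    have "X y i n -` {..y + int m} \<inter> space M \<in> sets M"
      using meas that by (intro measurable_sets) auto
    then show ?thesis by (simp add: vimage_def Int_def conj_commute)
  qed
  have "\<P>(w in M. \<exists>y i. y \<in> S \<and> 1 \<le> i \<and> real i \<le> q \<and> real_of_int (X y i n w - y) \<le> a)
      \<le> prob (\<Union>y\<in>S. \<Union>i\<in>?I. ?E y i)"
  proof (intro finite_measure_mono subsetI)
    fix w assume "w \<in> {w \<in> space M. \<exists>y i. y \<in> S \<and> 1 \<le> i \<and> real i \<le> q \<and> real_of_int (X y i n w - y) \<le> a}"
    then obtain y i where yi: "w \<in> space M" "y \<in> S" "1 \<le> i" "real i \<le> q" "real_of_int (X y i n w - y) \<le> a"
      by blast
    have "real_of_int (X y i n w - y) \<le> real_of_int (int m)" using yi(5) m by simp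
    then have "X y i n w - y \<le> int m" by (simp only: of_int_le_iff)
    then have "w \<in> ?E y i" using yi(1) by simp
    moreover have "i \<in> ?I" using yi(3,4) by (simp add: le_nat_floor)
    ultimately show "w \<in> (\<Union>y\<in>S. \<Union>i\<in>?I. ?E y i)" using yi(2) by blast
  next
    show "(\<Union>y\<in>S. \<Union>i\<in>?I. ?E y i) \<in> sets M"
      using S E by (intro sets.finite_UN) auto
  qed
  also have "\<dots> \<le> (\<Sum>y\<in>S. prob (\<Union>i\<in>?I. ?E y i))"
    using S E by (intro finite_measure_subadditive_finite) (auto intro!: sets.finite_UN)
  also have "\<dots> \<le> (\<Sum>y\<in>S. \<Sum>i\<in>?I. prob (?E y i))"
    using E by (intro sum_mono finite_measure_subadditive_finite) auto
  also have "\<dots> \<le> (\<Sum>y\<in>S. \<Sum>i\<in>?I. u)"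
  proof (intro sum_mono)
    fix y i assume "y \<in> S" "i \<in> ?I"
    then have "prob (?E y i) = iter_step \<omega> {..y + int m} n y"
      by (intro quenched_chain_law[OF prob_space_axioms chain]) auto
    with bound[OF \<open>y \<in> S\<close>] show "prob (?E y i) \<le> u" by simp
  qed
  also have "\<dots> \<le> (\<Sum>y\<in>S. q * u)"
    using q by (intro sum_mono) (simp add: mult_right_mono)
  finally show ?thesis by simp
qed

text \<open>Polynomial prefactors contribute only a multiple of \<open>ln n\<close> to the
  logarithm, which is negligible against \<open>n powr e\<close>; division by
  \<open>n powr e'\<close> leaves a negative multiple of \<open>n powr (e - e')\<close>.\<close>

lemma scaled_log_tendsto_MInf:
  fixes p :: "nat \<Rightarrow> real" and D \<gamma> \<epsilon> e e' :: real
  assumes p: "\<forall>\<^sub>F n in sequentially. p n \<le> (D * real n + 1) * (real n powr \<gamma> * exp (- (\<epsilon> * real n powr e)))"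
    and "D \<ge> 0" "\<epsilon> > 0" "e > 0" "e' < e"
  shows "limsup (\<lambda>n. ereal (1 / real n powr e') * elog (p n)) = -\<infinity>"
proof (rule lim_imp_Limsup)
  have ev: "\<forall>\<^sub>F n in sequentially. ereal (1 / real n powr e') * elog (p n) \<le> ereal (- (\<epsilon> / 2) * real n powr (e - e'))"
  proof -
    \<comment> \<open>The absolute value of \<open>\<gamma>\<close> treats both signs of
      \<open>\<gamma>\<close> at once.\<close>
    have "((\<lambda>n. (ln (D * real n + 1) + \<bar>\<gamma>\<bar> * ln (real n)) / real n powr e) \<longlongrightarrow> 0) sequentially"
    proof -
      have "((\<lambda>n. ln (D * real n + 1) / real n powr e) \<longlongrightarrow> 0) sequentially"
        using \<open>D \<ge> 0\<close> \<open>e > 0\<close>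
        by (cases "D = 0") (simp, (subgoal_tac "D > 0", real_asymp, simp))
      moreover have "((\<lambda>n. ln (real n) / real n powr e) \<longlongrightarrow> 0) sequentially"
        using \<open>e > 0\<close> by real_asymp
      ultimately have "((\<lambda>n. ln (D * real n + 1) / real n powr e + \<bar>\<gamma>\<bar> * (ln (real n) / real n powr e))
          \<longlongrightarrow> 0 + \<bar>\<gamma>\<bar> * 0) sequentially"
        by (intro tendsto_intros)
      then show ?thesis by (simp add: add_divide_distrib)
    qed
    then have "\<forall>\<^sub>F n in sequentially. (ln (D * real n + 1) + \<bar>\<gamma>\<bar> * ln (real n)) / real n powr e < \<epsilon> / 2"
      by (rule order_tendstoD) (use \<open>\<epsilon> > 0\<close> in simp)
    then show ?thesis
      using p eventually_ge_at_top[of 1]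
    proof eventually_elim
      case (elim n)
      define U where "U = (D * real n + 1) * (real n powr \<gamma> * exp (- (\<epsilon> * real n powr e)))"
      have D1: "D * real n + 1 > 0" using \<open>D \<ge> 0\<close> by (simp add: add_nonneg_pos)
      then have "U > 0" using elim(3) by (simp add: U_def)
      have "ln U = ln (D * real n + 1) + (\<gamma> * ln (real n) - \<epsilon> * real n powr e)"
        using D1 elim(3) unfolding U_def by (simp add: ln_mult ln_powr)
      moreover have "\<gamma> * ln (real n) \<le> \<bar>\<gamma>\<bar> * ln (real n)"
        using elim(3) by (intro mult_right_mono) auto
      moreover have "ln (D * real n + 1) + \<bar>\<gamma>\<bar> * ln (real n) < \<epsilon> / 2 * real n powr e"
        using elim(1,3) by (simp add: divide_less_eq)
      ultimately have ln_U: "ln U \<le> - (\<epsilon> / 2) * real n powr e"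
        by simp
      have "elog (p n) \<le> elog U" using elim(2) by (intro elog_mono) (simp add: U_def)
      also have "elog U \<le> ereal (- (\<epsilon> / 2) * real n powr e)"
        using \<open>U > 0\<close> ln_U by (simp add: elog_def)
      finally have "ereal (1 / real n powr e') * elog (p n)
          \<le> ereal (1 / real n powr e') * ereal (- (\<epsilon> / 2) * real n powr e)"
        by (intro ereal_mult_left_mono) auto
      also have "\<dots> = ereal (- (\<epsilon> / 2) * real n powr (e - e'))"
        by (simp add: powr_diff)
      finally show ?case .
    qed
  qed
  have "filterlim (\<lambda>n. - (\<epsilon> / 2) * real n powr (e - e')) at_bot sequentially"
    using \<open>\<epsilon> > 0\<close> \<open>e' < e\<close> by real_asymp
  then have bot: "\<forall>\<^sub>F n in sequentially. - (\<epsilon> / 2) * real n powr (e - e') < r" for r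
    by (simp add: filterlim_at_bot_dense)
  show "((\<lambda>n. ereal (1 / real n powr e') * elog (p n)) \<longlongrightarrow> -\<infinity>) sequentially"
    unfolding tendsto_MInfty
  proof
    fix r
    show "\<forall>\<^sub>F n in sequentially. ereal (1 / real n powr e') * elog (p n) < ereal r"
      using ev bot[of r] by eventually_elim (auto elim: le_less_trans)
  qed
qed simp

section \<open>Moments between 1 and \<open>s\<close>, and the choice of the inflation\<close>

text \<open>Young's inequality for \<open>p\<close> written as a convex combination of 1 and
  \<open>s\<close>. Integrated, it transfers the first moment below 1 and the \<open>s\<close>-th
  moment equal to 1 to a \<open>p\<close>-th moment below 1.\<close>

lemma powr_interpolate:
  fixes x :: real
  assumes "x \<ge> 0" "1 \<le> p" "p \<le> s" "1 < s"
  shows "x powr p \<le> (s - p) / (s - 1) * x + (p - 1) / (s - 1) * x powr s"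
proof (cases "x = 0")
  case False
  define \<theta> where "\<theta> = (s - p) / (s - 1)"
  have \<theta>: "0 \<le> \<theta>" "0 \<le> 1 - \<theta>" and eq: "1 - \<theta> = (p - 1) / (s - 1)"
    using assms by (auto simp: \<theta>_def field_simps)
  have "x powr p = x powr \<theta> * (x powr s) powr (1 - \<theta>)"
  proof -
    have "p = \<theta> + s * (1 - \<theta>)"
    proof -
      have "(s - p) + s * (p - 1) = p * (s - 1)"
        by (simp add: algebra_simps)
      then show ?thesis
        unfolding eq unfolding \<theta>_def times_divide_eq_right add_divide_distrib[symmetric]
        using assms by simp
    qed
    then show ?thesis by (simp add: powr_powr flip: powr_add)
  qed
  also have "\<dots> \<le> \<theta> * x + (1 - \<theta>) * x powr s"
    using \<theta> assms(1) False by (intro Youngs_inequality_0) auto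
  finally show ?thesis unfolding eq unfolding \<theta>_def .
qed simp

text \<open>At \<open>\<kappa> = 0\<close> the required inequalities are strict, the last one being
  the assumption that \<open>v\<close> is below the speed; by continuity they persist for small
  positive \<open>\<kappa>\<close>, and \<open>b\<close> is then found by density.\<close>

lemma exists_inflation:
  fixes v m \<beta> :: real
  assumes "0 < v" "0 \<le> m" "m < 1" "v < (1 - m) / (1 + m)" "0 < \<beta>" "\<beta> < 1"
  obtains \<kappa> b where "\<kappa> > 0" "(1 + \<kappa>) * \<beta> < 1" "(1 + \<kappa>) * m < 1"
    "(1 + m) / (1 - (1 + \<kappa>) * m) < b" "(1 + \<kappa>) * b * v < 1"
proof -
  have "((\<lambda>\<kappa>. (1 + \<kappa>) * \<beta>) \<longlongrightarrow> (1 + 0) * \<beta>) (at_right 0)"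
    by (intro tendsto_intros)
  then have 1: "\<forall>\<^sub>F \<kappa> in at_right 0. (1 + \<kappa>) * \<beta> < 1"
    by (rule order_tendstoD) (use assms in simp)
  have "((\<lambda>\<kappa>. (1 + \<kappa>) * m) \<longlongrightarrow> (1 + 0) * m) (at_right 0)"
    by (intro tendsto_intros)
  then have 2: "\<forall>\<^sub>F \<kappa> in at_right 0. (1 + \<kappa>) * m < 1"
    by (rule order_tendstoD) (use assms in simp)
  have "((\<lambda>\<kappa>. (1 + \<kappa>) * ((1 + m) / (1 - (1 + \<kappa>) * m)) * v)
      \<longlongrightarrow> (1 + 0) * ((1 + m) / (1 - (1 + 0) * m)) * v) (at_right 0)"
    using assms by (intro tendsto_intros) auto
  then have 3: "\<forall>\<^sub>F \<kappa> in at_right 0. (1 + \<kappa>) * ((1 + m) / (1 - (1 + \<kappa>) * m)) * v < 1"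
    by (rule order_tendstoD) (use assms in \<open>simp add: field_simps\<close>)
  have 4: "\<forall>\<^sub>F \<kappa> in at_right 0. (0::real) < \<kappa>"
    by (simp add: eventually_at_filter)
  have "\<forall>\<^sub>F \<kappa> in at_right (0::real). 0 < \<kappa> \<and> (1 + \<kappa>) * \<beta> < 1 \<and> (1 + \<kappa>) * m < 1 \<and>
      (1 + \<kappa>) * ((1 + m) / (1 - (1 + \<kappa>) * m)) * v < 1"
    using 1 2 3 4 by eventually_elim auto
  then obtain \<kappa> where \<kappa>: "0 < \<kappa>" "(1 + \<kappa>) * \<beta> < 1" "(1 + \<kappa>) * m < 1"
      "(1 + \<kappa>) * ((1 + m) / (1 - (1 + \<kappa>) * m)) * v < 1"
    using eventually_happens'[OF trivial_limit_at_right_real] by blast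
  define \<mu> where "\<mu> = (1 + m) / (1 - (1 + \<kappa>) * m)"
  have "\<mu> < 1 / ((1 + \<kappa>) * v)"
    using \<kappa>(1,4) assms(1) unfolding \<mu>_def[symmetric]
    by (subst pos_less_divide_eq) (auto simp: mult_ac)
  then obtain b where "\<mu> < b" "b < 1 / ((1 + \<kappa>) * v)"
    using dense by blast
  then have "(1 + \<kappa>) * b * v < 1"
    using \<kappa>(1) assms(1) by (subst (asm) pos_less_divide_eq) (auto simp: mult_ac)
  with \<kappa> \<open>\<mu> < b\<close> show ?thesis
    using that unfolding \<mu>_def by blast
qed

section \<open>Reduction of elliptic environments to bounded ratios\<close>

text \<open>Clipping to the interval from 0 to \<open>1 / c\<close> acts on each site by the same
  measurable function, so independence and identical laws are inherited.\<close>

lemma iid_environment_bounded_iid: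
  assumes "iid_environment P" "c > 0"
  shows "bounded_iid P (\<lambda>j \<omega>. min (1 / c) (max 0 (rho \<omega> j))) (1 / c)"
proof -
  interpret prob_space P using assms by (simp add: iid_environment_def)
  let ?f = "\<lambda>x :: real. min (1 / c) (max 0 ((1 - x) / x))"
  have ind: "indep_vars (\<lambda>_. borel) (\<lambda>x \<omega>. \<omega> x) UNIV"
    and ident: "\<And>x. distr P borel (\<lambda>\<omega>. \<omega> x) = distr P borel (\<lambda>\<omega>. \<omega> 0)"
    using assms by (auto simp: iid_environment_def)
  have [measurable]: "(\<lambda>\<omega>. \<omega> x) \<in> borel_measurable P" for x
    using ind by (auto simp: indep_vars_def)
  have "distr P borel (\<lambda>\<omega>. ?f (\<omega> j)) = distr (distr P borel (\<lambda>\<omega>. \<omega> j)) borel ?f" for j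
    by (subst distr_distr) (auto simp: comp_def)
  then have "distr P borel (\<lambda>\<omega>. ?f (\<omega> j)) = distr P borel (\<lambda>\<omega>. ?f (\<omega> 0))" for j
    using ident[of j] by (simp only:)
  then show ?thesis
    unfolding rho_def using \<open>c > 0\<close>
    by unfold_locales (auto intro!: indep_vars_compose2[OF ind])
qed

text \<open>Ellipticity passes from site 0 to every site through the common law, and there are
  countably many sites.\<close>

lemma iid_environment_AE_elliptic:
  assumes iid: "iid_environment P" and ell: "\<P>(\<omega> in P. \<omega> 0 \<in> {c..1 - c}) = 1"
  shows "AE \<omega> in P. \<forall>j. \<omega> j \<in> {c..1 - c}"
proof -
  interpret prob_space P using iid by (simp add: iid_environment_def)
  have [measurable]: "(\<lambda>\<omega>. \<omega> x) \<in> borel_measurable P" for x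
    using iid by (auto simp: iid_environment_def indep_vars_def)
  have "AE \<omega> in P. \<omega> 0 \<in> {c..1 - c}"
    using ell by (subst (asm) prob_Collect_eq_1) auto
  then have *: "AE x in distr P borel (\<lambda>\<omega>. \<omega> 0). x \<in> {c..1 - c}"
    by (subst AE_distr_iff) auto
  have "AE x in distr P borel (\<lambda>\<omega>. \<omega> j). x \<in> {c..1 - c}" for j
  proof -
    have "distr P borel (\<lambda>\<omega>. \<omega> j) = distr P borel (\<lambda>\<omega>. \<omega> 0)"
      using iid by (simp add: iid_environment_def)
    with * show ?thesis by (simp only:)
  qed
  then have "AE \<omega> in P. \<omega> j \<in> {c..1 - c}" for j
    by (subst (asm) AE_distr_iff) auto
  then show ?thesis by (simp add: AE_all_countable)
qed

theorem proposition1p2: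
  fixes P :: "(int \<Rightarrow> real) measure"
    and Q :: "(int \<Rightarrow> real) \<Rightarrow> 'w measure"
    and X :: "int \<Rightarrow> nat \<Rightarrow> nat \<Rightarrow> 'w \<Rightarrow> int"
    and c s A B v \<delta> \<gamma> :: real
  assumes "iid_environment P"
    and "c > 0" and "\<P>(\<omega> in P. \<omega> 0 \<in> {c..1 - c}) = 1"
    and "(\<integral>\<omega>. rho \<omega> 0 \<partial>P) < 1"
    and "s > 1" and "(\<integral>\<omega>. rho \<omega> 0 powr s \<partial>P) = 1"
    and "\<And>\<omega>. \<omega> \<in> space env_space \<Longrightarrow> quenched_walks \<omega> (Q \<omega>) X"
    and "A < B" and "0 < v" and "v < speed P" and "\<delta> > 0"
  shows "AE \<omega> in P.
    limsup (\<lambda>n. ereal (1 / real n powr (1 - 1 / s - \<delta>)) *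
      elog \<P>(w in Q \<omega>. \<exists>y i. A * real n < real_of_int y \<and> real_of_int y \<le> B * real n \<and>
        1 \<le> i \<and> real i \<le> real n powr \<gamma> \<and>
        real_of_int (X y i n w - y) \<le> real n * v)) = -\<infinity>"
proof -
  define r where "r j \<omega> = min (1 / c) (max 0 (rho \<omega> j))" for j :: int and \<omega>
  interpret bounded_iid P r "1 / c"
    using iid_environment_bounded_iid[OF assms(1,2)] by (simp add: r_def[abs_def])
  have elliptic: "AE \<omega> in P. \<forall>j. \<omega> j \<in> {c..1 - c}"
    using iid_environment_AE_elliptic assms(1,3) .
  have rho_eq: "rho \<omega> j = r j \<omega>" if "\<forall>j. \<omega> j \<in> {c..1 - c}" for \<omega> j
  proof -
    have "c \<le> \<omega> j" "\<omega> j \<le> 1 - c" using that by auto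
    then have "0 \<le> rho \<omega> j" "rho \<omega> j \<le> 1 / c"
      unfolding rho_def using \<open>c > 0\<close> by (auto intro!: frac_le)
    then show ?thesis by (simp add: r_def)
  qed
  have [measurable]: "(\<lambda>\<omega>. \<omega> 0) \<in> borel_measurable P"
    using assms(1) by (simp add: iid_environment_def indep_vars_def)
  have [measurable]: "(\<lambda>\<omega>. rho \<omega> 0) \<in> borel_measurable P"
    unfolding rho_def by measurable
  have E_rho: "(\<integral>\<omega>. rho \<omega> 0 \<partial>P) = expectation (r 0)"
    using elliptic by (intro integral_cong_AE) (auto simp: rho_eq)
  have E_rho_s: "(\<integral>\<omega>. rho \<omega> 0 powr s \<partial>P) = expectation (\<lambda>\<omega>. r 0 \<omega> powr s)"
    using elliptic by (intro integral_cong_AE) (auto simp: rho_eq)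
  define m where "m = expectation (r 0)"
  have m: "0 \<le> m" "m < 1"
    using assms(4) nonneg unfolding E_rho by (auto simp: m_def intro!: integral_nonneg_AE)
  define \<sigma> where "\<sigma> = 1 / s"
  have \<sigma>: "0 < \<sigma>" "\<sigma> < 1" using \<open>s > 1\<close> by (auto simp: \<sigma>_def)
  \<comment> \<open>Small enough that the exponent \<open>1 - \<sigma> - 4 * \<tau>\<close> is
    positive and exceeds \<open>1 - \<sigma> - \<delta>\<close>.\<close>
  define \<tau> where "\<tau> = min \<delta> (1 - \<sigma>) / 8"
  have "\<tau> > 0" "8 * \<tau> \<le> \<delta>" "8 * \<tau> \<le> 1 - \<sigma>"
    using \<open>\<delta> > 0\<close> \<sigma> by (auto simp: \<tau>_def)
  then have \<tau>: "\<tau> > 0" "4 * \<tau> < \<delta>" "\<sigma> + 4 * \<tau> < 1"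
    by linarith+
  \<comment> \<open>Possible because \<open>s * \<sigma> = 1\<close>: any \<open>p\<close> close
    enough to \<open>s\<close> from below works.\<close>
  obtain p where p: "1 < p" "p < s" "p * (\<sigma> + \<tau>) > 1"
  proof -
    have "1 / (\<sigma> + \<tau>) < s"
      using \<open>s > 1\<close> \<tau>(1) \<sigma>(1) by (simp add: \<sigma>_def field_simps add_pos_pos)
    then obtain p where "max 1 (1 / (\<sigma> + \<tau>)) < p" "p < s"
      using dense[of "max 1 (1 / (\<sigma> + \<tau>))" s] \<open>s > 1\<close> by auto
    moreover have "p * (\<sigma> + \<tau>) > 1"
      using \<open>max 1 (1 / (\<sigma> + \<tau>)) < p\<close> \<sigma>(1) \<tau>(1) by (simp add: pos_divide_less_eq)
    ultimately show ?thesis using that[of p] by simp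
  qed
  have q: "expectation (\<lambda>\<omega>. r 0 \<omega> powr p) < 1"
  proof -
    have "expectation (\<lambda>\<omega>. r 0 \<omega> powr p)
        \<le> expectation (\<lambda>\<omega>. (s - p) / (s - 1) * r 0 \<omega> + (p - 1) / (s - 1) * r 0 \<omega> powr s)"
      using p \<open>s > 1\<close> nonneg integrable_r_powr integrable_r
      by (intro integral_mono powr_interpolate) auto
    also have "\<dots> = (s - p) / (s - 1) * m + (p - 1) / (s - 1)"
      using integrable_r_powr[of s] integrable_r \<open>s > 1\<close> assms(6)
      by (simp add: m_def flip: E_rho_s)
    also have "\<dots> < (s - p) / (s - 1) * 1 + (p - 1) / (s - 1)"
      using m p \<open>s > 1\<close> by (intro add_strict_right_mono mult_strict_left_mono) auto
    also have "\<dots> = 1" using \<open>s > 1\<close> by (simp flip: add_divide_distrib)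
    finally show ?thesis .
  qed
  \<comment> \<open>The \<open>p\<close>-th root of a number strictly between the
    \<open>p\<close>-th moment and 1.\<close>
  obtain \<beta> where \<beta>: "0 < \<beta>" "\<beta> < 1" "expectation (\<lambda>\<omega>. r 0 \<omega> powr p) < \<beta> powr p"
  proof -
    have "0 \<le> expectation (\<lambda>\<omega>. r 0 \<omega> powr p)" by (intro integral_nonneg_AE) auto
    then obtain z where z: "expectation (\<lambda>\<omega>. r 0 \<omega> powr p) < z" "z < 1" "0 < z"
      using dense[OF q] by auto
    have "z powr (1 / p) < 1 powr (1 / p)"
      using z p by (intro powr_less_mono2) auto
    with that[of "z powr (1 / p)"] z p show ?thesis by (simp add: powr_powr)
  qed
  have "v < (1 - m) / (1 + m)"
    using \<open>v < speed P\<close> by (simp add: speed_def E_rho m_def)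
  then obtain \<kappa> b where \<kappa>: "\<kappa> > 0" "(1 + \<kappa>) * \<beta> < 1" "(1 + \<kappa>) * m < 1"
      "(1 + m) / (1 - (1 + \<kappa>) * m) < b" "(1 + \<kappa>) * b * v < 1"
    using exists_inflation[of v m \<beta>] \<open>0 < v\<close> m \<beta>(1,2) by blast
  have "0 < (1 + m) / (1 - (1 + \<kappa>) * m)" using m \<kappa>(3) by simp
  then have "b > 0" using \<kappa>(4) by linarith
  have growth: "AE \<omega> in P. \<exists>C. \<forall>j k. (\<Prod>i<k. r (j - int i) \<omega>)
      \<le> C * \<beta> ^ k * (1 + real_of_int \<bar>j\<bar>) powr (\<sigma> + \<tau>)"
    using p \<beta> by (intro AE_prod_growth[of p]) auto
  have sums: "AE \<omega> in P. \<forall>\<^sub>F n in sequentially. \<forall>y\<in>starts A B n.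
      (\<Sum>i<depth \<tau> n * num_blocks \<tau> v n.
        min (crossing_time \<kappa> (depth \<tau> n) (\<lambda>l. r l \<omega>) (y + int i)) (real n powr (\<sigma> + 2 * \<tau>)))
      \<le> b * real (depth \<tau> n * num_blocks \<tau> v n)"
    using \<kappa> \<open>v > 0\<close> \<open>A < B\<close> \<tau> unfolding m_def by (intro AE_crossing_time_sums) auto
  show ?thesis
    using elliptic growth sums AE_space
  proof eventually_elim
    case (elim \<omega>)
    have rho_fun: "(\<lambda>l. r l \<omega>) = rho \<omega>" using rho_eq[OF elim(1)] by auto
    obtain C where C: "\<And>j k. (\<Prod>i<k. rho \<omega> (j - int i))
        \<le> C * \<beta> ^ k * (1 + real_of_int \<bar>j\<bar>) powr (\<sigma> + \<tau>)"
      using elim(2) rho_eq[OF elim(1)] by auto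
    have walks: "quenched_walks \<omega> (Q \<omega>) X"
    proof -
      have "sets P = sets env_space" using assms(1) by (simp add: iid_environment_def)
      then have "space P = space env_space" by (rule sets_eq_imp_space_eq)
      with elim(4) assms(7) show ?thesis by simp
    qed
    define \<epsilon> where "\<epsilon> = (1 - (1 + \<kappa>) * b * v) / 2"
    have "\<epsilon> > 0" using \<kappa> by (simp add: \<epsilon>_def)
    have "\<forall>\<^sub>F n in sequentially. \<forall>y\<in>starts A B n.
        iter_step \<omega> {..y + int (depth \<tau> n * num_blocks \<tau> v n)} n y
          \<le> exp (- (\<epsilon> * real n powr (1 - \<sigma> - 4 * \<tau>)))"
      unfolding \<epsilon>_def
    proof (rule iter_step_slowdown[OF _ _ _ _ _ _ _ _ _ _ _ _ C])
      show "0 < \<omega> j" "\<omega> j \<le> 1" for j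
        using elim(1) \<open>c > 0\<close> by (auto intro: less_le_trans order_trans)
      show "rho \<omega> j \<le> 1 / c" for j
        using bounded rho_eq[OF elim(1)] by simp
    qed (use \<kappa> \<beta> \<sigma> \<tau> \<open>v > 0\<close> \<open>b > 0\<close> elim(3) rho_fun in auto)
    then have "\<forall>\<^sub>F n in sequentially.
        \<P>(w in Q \<omega>. \<exists>y i. A * real n < real_of_int y \<and> real_of_int y \<le> B * real n \<and>
          1 \<le> i \<and> real i \<le> real n powr \<gamma> \<and> real_of_int (X y i n w - y) \<le> real n * v)
        \<le> ((B - A) * real n + 1) * (real n powr \<gamma> * exp (- (\<epsilon> * real n powr (1 - \<sigma> - 4 * \<tau>))))"
      (is "\<forall>\<^sub>F n in _. ?p n \<le> _")
      using eventually_ge_at_top[of 1]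
    proof eventually_elim
      case (elim n)
      let ?u = "exp (- (\<epsilon> * real n powr (1 - \<sigma> - 4 * \<tau>)))"
      have "?p n \<le> real (card (starts A B n)) * (real n powr \<gamma> * ?u)"
      proof -
        have "\<P>(w in Q \<omega>. \<exists>y i. y \<in> starts A B n \<and> 1 \<le> i \<and> real i \<le> real n powr \<gamma> \<and>
            real_of_int (X y i n w - y) \<le> real n * v)
          \<le> real (card (starts A B n)) * (real n powr \<gamma> * ?u)"
          using elim(1)
          by (intro quenched_walks_union_bound[OF walks finite_starts _ _ _
              depth_num_blocks(1)[where \<tau> = \<tau>, OF \<open>v > 0\<close>]]) auto
        then show ?thesis by (simp only: mem_starts conj_assoc)
      qed
      also have "\<dots> \<le> ((B - A) * real n + 1) * (real n powr \<gamma> * ?u)"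
        using card_starts[of A B n] \<open>A < B\<close> by (intro mult_right_mono) auto
      finally show ?case .
    qed
    \<comment> \<open>The gap between the two exponents is
      \<open>\<delta> - 4 * \<tau> > 0\<close>.\<close>
    from scaled_log_tendsto_MInf[OF this, of "1 - \<sigma> - \<delta>"] show ?case
      unfolding \<sigma>_def[symmetric] using \<open>\<epsilon> > 0\<close> \<tau> \<open>A < B\<close> by simp
  qed
qed

end
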